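(* Suppose $\boldsymbol\xi\sim P$ satisfies density-level regular variation with index $s>0$ and limit $\varphi^\star$, and let $\nu^\star$ be its limiting tail measure. (i) Let $\{\boldsymbol\xi_u\}_{u>0}\in\mathcal T(P)$ (i.e. $\{\boldsymbol\xi_u\}$ is tail preserving for $\boldsymbol\xi$). Then for every regular asymptotically homogeneous multi-loss system $(L_1,\dots,L_K)\in\mathcal H_1$ and every nonempty subset $\mathcal J\subseteq[K]$ under consideration (i.e. $\mathcal J\in\mathfrak J$), $$\mathbb P\big(\boldsymbol\xi_u\in\mathcal S(u;\mathcal J)\big)\sim\mathbb P\big(\boldsymbol\xi\in\mathcal S(u;\mathcal J)\big),\qquad u\to\infty.$$ (ii) Conversely, if $\{\boldsymbol\xi_u\}_{u>0}\notin\mathcal T(P)$, then there exist $K\ge1$, a regular system of loss functionals $(L_1,\dots,L_K)\in\mathcal H_1$ and a nonempty subset $\mathcal J\subseteq[K]$ (with $\mathcal J\in\mathfrak J$) such that $$\mathbb P\big(\boldsymbol\xi_u\in\mathcal S(u;\mathcal J)\big)\not\sim\mathbb P\big(\boldsymbol\xi\in\mathcal S(u;\mathcal J)\big),\qquad u\to\infty.$$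
   Context: Setting. $\|\cdot\|$ is the Euclidean norm on $\mathbb R^d$; $\mathcal E\subset\mathbb R^d$ is a closed cone; $\Theta_{\mathcal E}=\{\boldsymbol z\in\mathcal E:\|\boldsymbol z\|=1\}$; $B_r=\{\boldsymbol z:\|\boldsymbol z\|\le r\}$; $d\boldsymbol\phi$ is surface measure on $\Theta_{\mathcal E}$, so $d\boldsymbol z=r^{d-1}\,dr\,d\boldsymbol\phi$ for $\boldsymbol z=r\boldsymbol\phi$. $\boldsymbol\xi\sim P$ is a random vector with density $f_{\boldsymbol\xi}$ supported on $\mathcal E$. $[K]=\{1,\dots,K\}$, and $a(u)\sim b(u)$ means $a(u)/b(u)\to1$. Density-level regular variation: $f_{\boldsymbol\xi}$ is continuous on $B_{r_0}^c\cap\mathcal E$ for some $r_0>0$, and there are $s>0$ and $\varphi^\star:\mathcal E\setminus\{\boldsymbol 0\}\to(0,\infty)$ with $t^{s+d}f_{\boldsymbol\xi}(t\boldsymbol z)\to\varphi^\star(\boldsymbol z)$ as $t\to\infty$, uniformly over compact subsets of $\mathcal E\setminus\{\boldsymbol 0\}$. $\boldsymbol M_0$-convergence: $\boldsymbol M_0$ is the class of nonnegative Borel measures on $\mathcal E\setminus\{\boldsymbol0\}$ that are finite on $\{\|\boldsymbol z\|>r\}$ for every $r>0$. $\mu_n\to\mu$ in $\boldsymbol M_0$ if $\mu_n(B)\to\mu(B)$ for every Borel $B$ with $\mu(\partial B)=0$ and $\boldsymbol0\notin\operatorname{cl}(B)$ (and similarly for a continuous parameter $u\to\infty$). Limiting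 tail measure: $\nu^\star$ is the measure on $\mathcal E\setminus\{\boldsymbol0\}$ given in polar coordinates by $d\nu^\star(r,\boldsymbol\phi)=r^{-(s+1)}\varphi^\star(\boldsymbol\phi)\,dr\,d\boldsymbol\phi$; it is the $\boldsymbol M_0$-limit of $t^s\mathbb P(t^{-1}\boldsymbol\xi\in\cdot)$. Tail preservation: a family of $\mathcal E$-valued random vectors $\{\boldsymbol\xi_u\}_{u>0}$ is tail preserving for $\boldsymbol\xi$, written $\{\boldsymbol\xi_u\}\in\mathcal T(P)$, if $u^s\mathbb P(u^{-1}\boldsymbol\xi_u\in\cdot)\to\nu^\star$ in $\boldsymbol M_0$ as $u\to\infty$. Loss systems: measurable functions $L_1,\dots,L_K:\mathcal E\to\mathbb R$ form an asymptotically homogeneous multi-loss system, written $(L_1,\dots,L_K)\in\mathcal H_1$ or $\mathcal H_1(L_1^\star,\dots,L_K^\star)$, if for each $j$ there is $L_j^\star:\mathcal E\to\mathbb R$ with $\{L_j^\star>0\}\ne\varnothing$ and $t^{-1}L_j(t\boldsymbol z_t)\to L_j^\star(\boldsymbol z)$ whenever $t\to\infty$ and $\boldsymbol z_t\to\boldsymbol z$ in $\mathcal E$. For nonempty $\mathcal J\subseteq[K]$ and $u>0$, $\mathcal S(u;\mathcal J)=\{\boldsymbol z\in\mathcal E:L_j(\boldsymbol z)\ge u\ \forall j\in\mathcal J\}$ and $\mathcal S^\star(\mathcal J)=\{\boldsymbol z\in\mathcal E:L_j^\star(\boldsymbol z)\ge1\ \forall j\in\mathcal J\}$. Let $\mathfrak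 J$ denote the collection of nonempty subsets of $[K]$ under consideration; the system is regular if $\mathcal S^\star(\mathcal J)$ has nonzero Lebesgue measure for every $\mathcal J\in\mathfrak J$. *)

theory Defs
  imports "HOL-Probability.Probability" "HOL-Library.Landau_Symbols"
begin

definition density_regularly_varying ::
    "'a::euclidean_space set \<Rightarrow> ('a \<Rightarrow> real) \<Rightarrow> real \<Rightarrow> ('a \<Rightarrow> real) \<Rightarrow> bool" where
  "density_regularly_varying E f s \<phi> \<longleftrightarrow>
     0 < s \<and>
     (\<exists>r0>0. continuous_on (E - cball 0 r0) f) \<and>
     (\<forall>z\<in>E - {0}. 0 < \<phi> z) \<and>
     (\<forall>C. compact C \<and> C \<subseteq> E - {0} \<longrightarrow>
        uniform_limit C (\<lambda>t z. t powr (s + real DIM('a)) * f (t *\<^sub>R z)) \<phi> at_top)"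

text \<open>
  A measure on the punctured cone is a measure whose \<sigma>-algebra is that of
  \<^term>\<open>restrict_space borel (E - {0})\<close>. Boundaries are taken in the subspace
  \<^term>\<open>E - {0}\<close>, not in the ambient space, since that is where the measures live.
\<close>

definition M0 :: "'a::euclidean_space set \<Rightarrow> 'a measure set" where
  "M0 E = {\<mu>. sets \<mu> = sets (restrict_space borel (E - {0})) \<and>
              (\<forall>r>0. emeasure \<mu> {z \<in> E - {0}. r < norm z} < \<infinity>)}"

definition M0_tendsto ::
    "'a::euclidean_space set \<Rightarrow> ('i \<Rightarrow> 'a measure) \<Rightarrow> 'a measure \<Rightarrow> 'i filter \<Rightarrow> bool" where
  "M0_tendsto E \<mu> \<nu> F \<longleftrightarrow>
     (\<forall>\<^sub>F i in F. \<mu> i \<in> M0 E) \<and> \<nu> \<in> M0 E \<and>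
     (\<forall>B \<in> sets (restrict_space borel (E - {0})).
        emeasure \<nu> (top_of_set (E - {0}) frontier_of B) = 0 \<and> 0 \<notin> closure B \<longrightarrow>
        ((\<lambda>i. emeasure (\<mu> i) B) \<longlongrightarrow> emeasure \<nu> B) F)"

text \<open>
  Surface measure on the spherical part of the cone. The normalisation
  \<open>dz = r^(d-1) dr d\<phi>\<close> forces the surface measure of a set \<open>A\<close> of directions to be
  \<open>d\<close> times the Lebesgue measure of \<open>{z. 0 < norm z \<le> 1 \<and> z / norm z \<in> A}\<close>;
  note that \<^term>\<open>sgn z = z /\<^sub>R norm z\<close>.
\<close>

definition sphere_part :: "'a::euclidean_space set \<Rightarrow> 'a set" where
  "sphere_part E = {z \<in> E. norm z = 1}"

definition surface_measure :: "'a::euclidean_space set \<Rightarrow> 'a measure" where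
  "surface_measure E =
     scale_measure (of_nat DIM('a))
       (distr (restrict_space lborel {z \<in> E. 0 < norm z \<and> norm z \<le> 1})
              (restrict_space borel (sphere_part E)) sgn)"

definition limit_tail_measure ::
    "'a::euclidean_space set \<Rightarrow> real \<Rightarrow> ('a \<Rightarrow> real) \<Rightarrow> 'a measure" where
  "limit_tail_measure E s \<phi> =
     distr
       (density (restrict_space lborel {0<..} \<Otimes>\<^sub>M surface_measure E)
                (\<lambda>(r, w). ennreal (r powr (- (s + 1)) * \<phi> w)))
       (restrict_space borel (E - {0}))
       (\<lambda>(r, w). r *\<^sub>R w)"

text \<open>
  The members of the family may live on different probability spaces \<^term>\<open>N u\<close>;
  \<^term>\<open>scaled_law E s N X u\<close> is the measure \<open>u^s P(X_u / u \<in> \<cdot>)\<close> on \<^term>\<open>E - {0}\<close>.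
\<close>

definition scaled_law ::
    "'a::euclidean_space set \<Rightarrow> real \<Rightarrow> (real \<Rightarrow> 'c measure) \<Rightarrow> (real \<Rightarrow> 'c \<Rightarrow> 'a) \<Rightarrow> real \<Rightarrow> 'a measure" where
  "scaled_law E s N X u =
     scale_measure (ennreal (u powr s))
       (restrict_space (distr (N u) borel (\<lambda>\<omega>. X u \<omega> /\<^sub>R u)) (E - {0}))"

definition tail_preserving ::
    "'a::euclidean_space set \<Rightarrow> real \<Rightarrow> ('a \<Rightarrow> real) \<Rightarrow>
     (real \<Rightarrow> 'c measure) \<Rightarrow> (real \<Rightarrow> 'c \<Rightarrow> 'a) \<Rightarrow> bool" where
  "tail_preserving E s \<phi> N X \<longleftrightarrow>
     M0_tendsto E (scaled_law E s N X) (limit_tail_measure E s \<phi>) at_top"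

definition asymp_homogeneous_system ::
    "'a::euclidean_space set \<Rightarrow> nat \<Rightarrow> (nat \<Rightarrow> 'a \<Rightarrow> real) \<Rightarrow> (nat \<Rightarrow> 'a \<Rightarrow> real) \<Rightarrow> bool" where
  "asymp_homogeneous_system E K L Lstar \<longleftrightarrow>
     (\<forall>j\<in>{1..K}.
        L j \<in> borel_measurable (restrict_space borel E) \<and>
        (\<exists>z\<in>E. 0 < Lstar j z) \<and>
        (\<forall>z\<in>E. \<forall>\<zeta>. (\<forall>t. \<zeta> t \<in> E) \<and> (\<zeta> \<longlongrightarrow> z) at_top \<longrightarrow>
           ((\<lambda>t::real. L j (t *\<^sub>R \<zeta> t) / t) \<longlongrightarrow> Lstar j z) at_top))"

definition joint_exceedance ::
    "'a set \<Rightarrow> (nat \<Rightarrow> 'a \<Rightarrow> real) \<Rightarrow> real \<Rightarrow> nat set \<Rightarrow> 'a set" where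
  "joint_exceedance E L u J = {z \<in> E. \<forall>j\<in>J. u \<le> L j z}"

definition regular_system ::
    "'a::euclidean_space set \<Rightarrow> (nat \<Rightarrow> 'a \<Rightarrow> real) \<Rightarrow> nat set set \<Rightarrow> bool" where
  "regular_system E Lstar \<JJ> \<longleftrightarrow>
     (\<forall>J\<in>\<JJ>. emeasure lborel (joint_exceedance E Lstar 1 J) \<noteq> 0)"

end

theory Submission
  imports Defs
begin

text \<open>
  In polar coordinates \<open>\<nu>\<^sup>\<star>\<close> has Lebesgue density \<open>\<phi>\<close>, which is homogeneous of degree \<open>-(s+d)\<close>. Hence
  \<open>\<nu>\<^sup>\<star>\<close> scales by \<open>c\<^sup>-\<^sup>s\<close>, and a set \<open>{g\<^sub>j \<ge> 1 for all j}\<close> cut out by continuous \<open>1\<close>-homogeneous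
  \<open>g\<^sub>j\<close> has a \<open>\<nu>\<^sup>\<star>\<close>-null boundary. Dominated convergence shows that \<open>\<xi>\<close> itself is tail preserving.

  (i) On \<open>{norm z \<ge> r}\<close> the functional \<open>L\<^sub>j(uz)/u\<close> lies eventually between the homogeneous functionals
  \<open>L\<^sub>j\<^sup>\<star>(z) \<plusminus> \<epsilon> norm z\<close>, so \<open>u\<^sup>s P(\<xi>\<^sub>u \<in> S(u;J))\<close> and \<open>u\<^sup>s P(\<xi> \<in> S(u;J))\<close> have the same limit
  \<open>\<nu>\<^sup>\<star>(S\<^sup>\<star>(J))\<close>, which is positive by regularity.

  (ii) If the equivalence held for every single homogeneous loss \<open>L = g\<close>, the scaled laws would converge
  on all sets \<open>{g \<ge> 1}\<close>. These sets are stable under intersection, and their differences contain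
  arbitrarily small neighbourhoods of each nonzero point, so a portmanteau argument gives
  convergence in \<open>M\<^sub>0\<close>. When \<open>{g \<ge> 1}\<close> is a Lebesgue null set, \<open>g\<close> is not an admissible loss;
  then \<open>max g (c norm)\<close> is, and letting \<open>c \<rightarrow> 0\<close> bounds the mass of \<open>{g \<ge> 1}\<close>.
\<close>

section \<open>Polar coordinates on a cone\<close>

text \<open>In (i) the rescaled exceedance set moves with u, and its boundary is uncontrolled
  because the losses are merely measurable; it has to be trapped between fixed sets to which
  convergence in M0 applies. These fixed sets have null boundary for one reason: the mass of {g
  \<ge> c} is finite and proportional to c^-s, so the levels slightly above 1 already fill {g \<ge>
  1} up to a null set. The laws of \<xi> and of the family are never compared with each other: each
  is compared with \<nu>, and positivity of the common limit turns two limits into an equivalence of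
  probabilities. In (ii) the available test sets are closed and sit at a fixed level, while a
  portmanteau argument needs lower bounds on open sets. Differences {p \<ge> 1} - {q \<ge> 1} supply
  neighbourhood bases at nonzero points. A single loss suffices, because an intersection of level
  sets is the level set of a minimum.\<close>

lemma nn_integral_lborel_scaleR:
  fixes f :: "'a::euclidean_space \<Rightarrow> ennreal"
  assumes [measurable]: "f \<in> borel_measurable borel" and c: "0 < c"
  shows "(\<integral>\<^sup>+z. f z \<partial>lborel) = ennreal (c ^ DIM('a)) * (\<integral>\<^sup>+z. f (c *\<^sub>R z) \<partial>lborel)"
proof -
  have "(\<integral>\<^sup>+z. f z \<partial>lborel)
      = (\<integral>\<^sup>+z. f z \<partial>density (distr lborel borel (\<lambda>x. 0 + c *\<^sub>R x)) (\<lambda>_. \<bar>c\<bar> ^ DIM('a)))"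
    using c lborel_affine[of c "0::'a"] by simp
  also have "\<dots> = ennreal (c ^ DIM('a)) * (\<integral>\<^sup>+z. f (c *\<^sub>R z) \<partial>lborel)"
    using c by (simp add: nn_integral_density nn_integral_distr nn_integral_cmult)
  finally show ?thesis .
qed

lemma borel_measurable_sgn_vector [measurable]:
  "(sgn :: 'a::euclidean_space \<Rightarrow> 'a) \<in> borel_measurable borel"
  unfolding sgn_div_norm by measurable

lemma sgn_scaleR_pos: "0 < c \<Longrightarrow> sgn (c *\<^sub>R z) = sgn (z::'a::real_normed_vector)"
  by (simp add: sgn_scaleR)

lemma cone_scaleR_iff:
  fixes E :: "'a::real_vector set"
  assumes "cone E" "0 < c"
  shows "c *\<^sub>R z \<in> E \<longleftrightarrow> z \<in> E"
  using mem_cone[OF assms(1), of z c] mem_cone[OF assms(1), of "c *\<^sub>R z" "inverse c"] assms(2)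
  by auto

lemma cone_sgn_iff:
  fixes E :: "'a::real_normed_vector set"
  assumes "cone E" "z \<noteq> 0"
  shows "sgn z \<in> E \<longleftrightarrow> z \<in> E"
  using cone_scaleR_iff[OF assms(1), of "inverse (norm z)" z] assms(2) by (simp add: sgn_div_norm)

lemma sphere_part_measurable [measurable]: "closed E \<Longrightarrow> sphere_part E \<in> sets borel"
  unfolding sphere_part_def by measurable

lemma compact_sphere_part:
  fixes E :: "'a::euclidean_space set"
  assumes "closed E"
  shows "compact (sphere_part E)"
proof -
  have "sphere_part E = sphere 0 1 \<inter> E" by (auto simp: sphere_part_def)
  then show ?thesis using assms by auto
qed

lemma space_surface_measure [simp]: "space (surface_measure E) = sphere_part E"
  by (simp add: surface_measure_def space_scale_measure space_restrict_space)

lemma sets_surface_measure [measurable_cong]: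
  "sets (surface_measure E) = sets (restrict_space borel (sphere_part E))"
  by (simp add: surface_measure_def)

lemma surface_measure_set_borel:
  assumes "closed E" "B \<in> sets (surface_measure E)"
  shows "B \<in> sets borel" "B \<subseteq> sphere_part E"
  using assms sphere_part_measurable[OF assms(1)]
  by (auto simp: sets_surface_measure sets_restrict_space_iff)

text \<open>Since \<open>B\<close> lies on the sphere part of a cone, \<open>sgn z \<in> B\<close>
  already forces \<open>z \<in> E\<close>, so the restriction to \<open>E\<close> disappears and a
  plain volume of a truncated cone is left.\<close>

lemma emeasure_surface_measure:
  fixes E :: "'a::euclidean_space set"
  assumes E: "closed E" "cone E" and B: "B \<in> sets (surface_measure E)"
  shows "emeasure (surface_measure E) B =
    of_nat DIM('a) * emeasure lborel {z. 0 < norm z \<and> norm z \<le> 1 \<and> sgn z \<in> B}"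
proof -
  have [measurable]: "E \<in> sets borel" using E by auto
  let ?S = "{z \<in> E. 0 < norm z \<and> norm z \<le> 1}"
  have S: "?S \<in> sets borel" by measurable
  have m: "sgn \<in> restrict_space lborel ?S \<rightarrow>\<^sub>M restrict_space borel (sphere_part E)"
    by (rule measurable_restrict_space2)
       (auto simp: space_restrict_space sphere_part_def norm_sgn cone_sgn_iff[OF E(2)]
             intro!: measurable_restrict_space1)
  have eq: "sgn -` B \<inter> ?S = {z. 0 < norm z \<and> norm z \<le> 1 \<and> sgn z \<in> B}"
    using surface_measure_set_borel[OF E(1) B] cone_sgn_iff[OF E(2)]
    by (auto simp: sphere_part_def)
  have "emeasure (surface_measure E) B = of_nat DIM('a) * emeasure (restrict_space lborel ?S) (sgn -` B \<inter> ?S)"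
    using B m by (simp add: surface_measure_def emeasure_distr space_restrict_space)
  also have "emeasure (restrict_space lborel ?S) (sgn -` B \<inter> ?S) = emeasure lborel (sgn -` B \<inter> ?S)"
    using S by (subst emeasure_restrict_space) auto
  finally show ?thesis unfolding eq .
qed

lemma finite_measure_surface_measure:
  fixes E :: "'a::euclidean_space set"
  assumes E: "closed E" "cone E"
  shows "finite_measure (surface_measure E)"
proof
  have "emeasure lborel {z. 0 < norm z \<and> norm z \<le> 1 \<and> sgn z \<in> sphere_part E}
      \<le> emeasure lborel (cball (0::'a) 1)"
    by (intro emeasure_mono) auto
  also have "\<dots> < \<infinity>" by (rule emeasure_lborel_cball_finite)
  finally have "emeasure lborel {z. 0 < norm z \<and> norm z \<le> 1 \<and> sgn z \<in> sphere_part E} < \<infinity>" .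
  then show "emeasure (surface_measure E) (space (surface_measure E)) \<noteq> \<infinity>"
    using sets.top[of "surface_measure E"] ennreal_mult_eq_top_iff
    by (subst emeasure_surface_measure[OF E]) (auto simp: ennreal_mult_eq_top_iff)
qed

text \<open>Dilation by \<open>a\<close> carries the truncated cone of radius 1 over
  \<open>B\<close> to the one of radius \<open>a\<close>.\<close>

lemma emeasure_lborel_cone_ball:
  fixes B :: "'a::euclidean_space set"
  assumes [measurable]: "B \<in> sets borel" and a: "0 < a"
  shows "emeasure lborel {z. 0 < norm z \<and> norm z \<le> a \<and> sgn z \<in> B}
    = ennreal (a ^ DIM('a)) * emeasure lborel {z. 0 < norm z \<and> norm z \<le> 1 \<and> sgn z \<in> B}"
proof -
  have "(\<integral>\<^sup>+z. indicator {z. 0 < norm z \<and> norm z \<le> a \<and> sgn z \<in> B} z \<partial>lborel)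
    = ennreal (a ^ DIM('a)) *
      (\<integral>\<^sup>+z. indicator {z. 0 < norm z \<and> norm z \<le> a \<and> sgn z \<in> B} (a *\<^sub>R z) \<partial>lborel)"
    using a by (intro nn_integral_lborel_scaleR) auto
  also have "(\<lambda>z. indicator {z. 0 < norm z \<and> norm z \<le> a \<and> sgn z \<in> B} (a *\<^sub>R z) :: ennreal)
    = indicator {z. 0 < norm z \<and> norm z \<le> 1 \<and> sgn z \<in> B}"
    using a by (auto simp: fun_eq_iff indicator_def sgn_scaleR_pos)
  finally show ?thesis by simp
qed

lemma nn_integral_power_Ioc:
  assumes "0 \<le> a"
  shows "(\<integral>\<^sup>+r. ennreal (r ^ n) * indicator {0<..a} r \<partial>lborel) = ennreal (a ^ Suc n / Suc n)"
proof -
  have "(\<integral>\<^sup>+r. ennreal (r ^ n) * indicator {0<..a} r \<partial>lborel)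
      = (\<integral>\<^sup>+r. ennreal (r ^ n) * indicator {0..a} r \<partial>lborel)"
    by (rule nn_integral_cong_AE, rule AE_mp[OF AE_lborel_singleton[of 0]])
       (auto intro!: AE_I2 simp: indicator_def)
  also have "\<dots> = ennreal (a ^ Suc n / Suc n - 0 ^ Suc n / Suc n)"
    by (rule nn_integral_FTC_Icc)
       (use assms in \<open>auto intro!: derivative_eq_intros simp del: power_Suc of_nat_Suc simp: field_simps\<close>)
  finally show ?thesis by simp
qed

text \<open>For a fixed set \<open>B\<close> of directions both sides are measures in
  \<open>A\<close> on the line. They agree and are finite on the half-lines \<open>{..a}\<close>, an
  intersection-stable generator of the Borel sets, because the truncated cone of radius a over
  \<open>B\<close> has volume proportional to a^d.\<close>

lemma emeasure_lborel_polar_rectangle: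
  fixes E :: "'a::euclidean_space set"
  assumes E: "closed E" "cone E" and B: "B \<in> sets (surface_measure E)" and A: "A \<in> sets borel"
  shows "(\<integral>\<^sup>+r. ennreal (r ^ (DIM('a) - 1)) * indicator ({0<..} \<inter> A) r \<partial>lborel) * emeasure (surface_measure E) B
    = emeasure lborel {z. z \<noteq> 0 \<and> norm z \<in> A \<and> sgn z \<in> B}"
proof -
  note [measurable] = surface_measure_set_borel(1)[OF E(1) B]
  let ?c = "emeasure (surface_measure E) B"
  let ?S = "{z::'a. z \<noteq> 0 \<and> sgn z \<in> B}"
  let ?M1 = "density lborel (\<lambda>r. ennreal (r ^ (DIM('a) - 1)) * indicator {0<..} r * ?c)"
  let ?M2 = "distr (restrict_space lborel ?S) borel norm"
  have S[measurable]: "?S \<in> sets borel" by measurable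
  have M1: "emeasure ?M1 A = (\<integral>\<^sup>+r. ennreal (r ^ (DIM('a) - 1)) * indicator ({0<..} \<inter> A) r \<partial>lborel) * ?c"
    if [measurable]: "A \<in> sets borel" for A
    by (subst emeasure_density, measurable, subst nn_integral_multc[symmetric])
       (auto intro!: nn_integral_cong simp: indicator_def)
  have M2: "emeasure ?M2 A = emeasure lborel {z. z \<noteq> 0 \<and> norm z \<in> A \<and> sgn z \<in> B}"
    if [measurable]: "A \<in> sets borel" for A
  proof -
    have "emeasure ?M2 A = emeasure (restrict_space lborel ?S) (norm -` A \<inter> ?S)"
      by (subst emeasure_distr) (auto simp: space_restrict_space intro!: measurable_restrict_space1)
    also have "\<dots> = emeasure lborel (norm -` A \<inter> ?S)"
      by (subst emeasure_restrict_space) auto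
    also have "norm -` A \<inter> ?S = {z. z \<noteq> 0 \<and> norm z \<in> A \<and> sgn z \<in> B}" by auto
    finally show ?thesis .
  qed
  have atMost: "emeasure ?M1 {..a} = emeasure ?M2 {..a}"
      "emeasure ?M1 {..a} \<noteq> \<infinity>" for a
  proof -
    have "emeasure ?M1 {..a} = emeasure ?M2 {..a} \<and> emeasure ?M1 {..a} \<noteq> \<infinity>"
    proof (cases "0 < a")
      case True
      have d: "Suc (DIM('a) - 1) = DIM('a)" using DIM_positive[where 'a='a] by simp
      have a1: "emeasure ?M1 {..a} = ennreal (a ^ DIM('a) / DIM('a)) * ?c"
        using nn_integral_power_Ioc[of a "DIM('a) - 1"] True d
        by (subst M1) (auto simp: greaterThanAtMost_def simp del: power_Suc)
      \<comment> \<open>The factor d in the normalisation of the surface measure cancels the 1/d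
        that comes from integrating r^(d-1).\<close>
      also have a2: "\<dots> = ennreal (a ^ DIM('a)) * emeasure lborel {z. 0 < norm z \<and> norm z \<le> 1 \<and> sgn z \<in> B}"
        using True DIM_positive[where 'a='a]
        by (simp add: emeasure_surface_measure[OF E B] mult.assoc[symmetric] ennreal_of_nat_eq_real_of_nat
            ennreal_mult[symmetric] del: DIM_positive)
      also have "\<dots> = emeasure ?M2 {..a}"
        using emeasure_lborel_cone_ball[of B a] True by (subst M2) auto
      finally have "emeasure ?M1 {..a} = emeasure ?M2 {..a}" .
      moreover have "?c \<noteq> \<infinity>"
        using finite_measure.emeasure_finite[OF finite_measure_surface_measure[OF E]] by auto
      then have "emeasure ?M1 {..a} \<noteq> \<infinity>"
        unfolding a1 by (simp add: ennreal_mult_eq_top_iff)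
      ultimately show ?thesis by blast
    next
      case False
      then have "{0<..} \<inter> {..a} = {}" "{z::'a. z \<noteq> 0 \<and> norm z \<in> {..a} \<and> sgn z \<in> B} = {}"
        by (auto simp: not_less dest: order_trans[of "norm _" a 0])
      then show ?thesis by (simp only: M1 M2 atMost_borel) simp
    qed
    then show "emeasure ?M1 {..a} = emeasure ?M2 {..a}" "emeasure ?M1 {..a} \<noteq> \<infinity>" by auto
  qed
  have "?M1 = ?M2"
  proof (rule measure_eqI_generator_eq)
    show "Int_stable (range (\<lambda>a::real. {..a}))"
      by (auto simp: Int_stable_def)
    show "range (\<lambda>n. {..real n}) \<subseteq> range (\<lambda>a::real. {..a})" by auto
    show "(\<Union>n. {..real n}) = UNIV" by (auto simp: real_arch_simple)
  qed (use atMost in \<open>auto simp: borel_eq_atMost\<close>)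
  then show ?thesis using M1[OF A] M2[OF A] by simp
qed

text \<open>The map z -> (norm z, sgn z) carries Lebesgue measure on \<open>E - {0}\<close> to the
  product of r^(d-1) dr and the surface measure: the two agree on rectangles, and rectangles
  determine a product of sigma-finite measures. The radial factor has infinite mass; the intervals
  \<open>{0<..n}\<close> make it sigma-finite.\<close>

lemma nn_integral_polar:
  fixes E :: "'a::euclidean_space set" and h :: "'a \<Rightarrow> ennreal"
  assumes E: "closed E" "cone E" and [measurable]: "h \<in> borel_measurable borel"
  shows "(\<integral>\<^sup>+z. h z * indicator (E - {0}) z \<partial>lborel) =
    (\<integral>\<^sup>+r. \<integral>\<^sup>+w. ennreal (r ^ (DIM('a) - 1)) * h (r *\<^sub>R w) \<partial>surface_measure E \<partial>restrict_space lborel {0<..})"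
proof -
  let ?\<sigma> = "surface_measure E" and ?L = "restrict_space lborel {0::real<..}"
  let ?R = "density ?L (\<lambda>r. ennreal (r ^ (DIM('a) - 1)))"
  let ?T = "\<lambda>z::'a. (norm z, sgn z)"
  have E'[measurable]: "E - {0} \<in> sets borel" using E by auto
  interpret \<sigma>: finite_measure ?\<sigma> by (rule finite_measure_surface_measure[OF E])
  have pw[measurable]: "(\<lambda>r::real. ennreal (r ^ (DIM('a) - 1))) \<in> borel_measurable ?L"
    by (intro measurable_restrict_space1) auto
  have R: "emeasure ?R A = (\<integral>\<^sup>+r. ennreal (r ^ (DIM('a) - 1)) * indicator ({0<..} \<inter> A) r \<partial>lborel)"
    if "A \<in> sets ?L" for A
    using that pw
    by (subst emeasure_density)
       (auto simp: nn_integral_restrict_space indicator_def intro!: nn_integral_cong)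
  interpret R: sigma_finite_measure ?R
  proof
    let ?A = "range (\<lambda>n. {0<..real n})"
    have "emeasure ?R {0<..real n} \<noteq> \<infinity>" for n
    proof -
      have "{0<..} \<inter> {0<..real n} = {0<..real n}" by auto
      then show ?thesis
        using nn_integral_power_Ioc[of "real n" "DIM('a) - 1"]
        by (subst R) (simp_all add: sets_restrict_space_iff greaterThanAtMost_def)
    qed
    then show "\<exists>A. countable A \<and> A \<subseteq> sets ?R \<and> \<Union> A = space ?R \<and> (\<forall>a\<in>A. emeasure ?R a \<noteq> \<infinity>)"
      by (intro exI[of _ ?A]) (auto simp: space_restrict_space sets_restrict_space_iff real_arch_simple)
  qed
  have idR[measurable]: "(\<lambda>r. r) \<in> ?R \<rightarrow>\<^sub>M borel"
    unfolding measurable_cong_sets[OF sets_density refl] by (intro measurable_restrict_space1) simp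
  have id\<sigma>[measurable]: "(\<lambda>w. w) \<in> ?\<sigma> \<rightarrow>\<^sub>M borel"
    unfolding measurable_cong_sets[OF sets_surface_measure refl]
    by (intro measurable_restrict_space1) simp
  have T: "?T \<in> restrict_space lborel (E - {0}) \<rightarrow>\<^sub>M ?R \<Otimes>\<^sub>M ?\<sigma>"
  proof (rule measurable_Pair)
    have "norm \<in> restrict_space lborel (E - {0}) \<rightarrow>\<^sub>M ?L"
      by (rule measurable_restrict_space2) (auto intro!: measurable_restrict_space1 simp: space_restrict_space)
    then show "norm \<in> restrict_space lborel (E - {0}) \<rightarrow>\<^sub>M ?R" by simp
    have "sgn \<in> restrict_space lborel (E - {0}) \<rightarrow>\<^sub>M restrict_space borel (sphere_part E)"
      by (rule measurable_restrict_space2)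
         (auto simp: space_restrict_space sphere_part_def norm_sgn cone_sgn_iff[OF E(2)]
             intro!: measurable_restrict_space1)
    then show "sgn \<in> restrict_space lborel (E - {0}) \<rightarrow>\<^sub>M ?\<sigma>"
      unfolding measurable_cong_sets[OF refl sets_surface_measure] .
  qed
  have eq: "?R \<Otimes>\<^sub>M ?\<sigma> = distr (restrict_space lborel (E - {0})) (?R \<Otimes>\<^sub>M ?\<sigma>) ?T"
  proof (rule pair_measure_eqI)
    fix A B assume AB: "A \<in> sets ?R" "B \<in> sets ?\<sigma>"
    then have "A \<in> sets ?L" by simp
    then have A: "A \<in> sets borel" by (auto simp: sets_restrict_space_iff)
    have "emeasure (distr (restrict_space lborel (E - {0})) (?R \<Otimes>\<^sub>M ?\<sigma>) ?T) (A \<times> B)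
      = emeasure (restrict_space lborel (E - {0})) (?T -` (A \<times> B) \<inter> (E - {0}))"
      using AB by (subst emeasure_distr[OF T]) (auto simp: space_restrict_space)
    also have "\<dots> = emeasure lborel (?T -` (A \<times> B) \<inter> (E - {0}))"
      using E' by (intro emeasure_restrict_space) auto
    also have "?T -` (A \<times> B) \<inter> (E - {0}) = {z. z \<noteq> 0 \<and> norm z \<in> A \<and> sgn z \<in> B}"
      using surface_measure_set_borel[OF E(1) AB(2)] cone_sgn_iff[OF E(2)]
      by (auto simp: sphere_part_def)
    also have "emeasure lborel \<dots> = emeasure ?R A * emeasure ?\<sigma> B"
      using emeasure_lborel_polar_rectangle[OF E AB(2) A] R[OF \<open>A \<in> sets ?L\<close>] by simp
    finally show "emeasure ?R A * emeasure ?\<sigma> B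
      = emeasure (distr (restrict_space lborel (E - {0})) (?R \<Otimes>\<^sub>M ?\<sigma>) ?T) (A \<times> B)" by simp
  next
    show "sigma_finite_measure ?R" "sigma_finite_measure ?\<sigma>" by unfold_locales
  qed auto
  have hm[measurable]: "(\<lambda>(r, w). h (r *\<^sub>R w)) \<in> borel_measurable (?R \<Otimes>\<^sub>M ?\<sigma>)"
    using measurable_compose[OF measurable_fst idR] measurable_compose[OF measurable_snd id\<sigma>]
    by (simp add: split_beta)
  have hw: "(\<lambda>w. h (r *\<^sub>R w)) \<in> borel_measurable ?\<sigma>" for r by measurable
  have "(\<integral>\<^sup>+z. h z * indicator (E - {0}) z \<partial>lborel) = (\<integral>\<^sup>+z. h z \<partial>restrict_space lborel (E - {0}))"
    using E' by (subst nn_integral_restrict_space) auto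
  also have "\<dots> = (\<integral>\<^sup>+z. (\<lambda>(r, w). h (r *\<^sub>R w)) (?T z) \<partial>restrict_space lborel (E - {0}))"
    by (simp add: sgn_div_norm space_restrict_space cong: nn_integral_cong_simp)
  also have "\<dots> = (\<integral>\<^sup>+p. (\<lambda>(r, w). h (r *\<^sub>R w)) p \<partial>distr (restrict_space lborel (E - {0})) (?R \<Otimes>\<^sub>M ?\<sigma>) ?T)"
    using T by (intro nn_integral_distr[symmetric]) auto
  also have "\<dots> = (\<integral>\<^sup>+p. (\<lambda>(r, w). h (r *\<^sub>R w)) p \<partial>(?R \<Otimes>\<^sub>M ?\<sigma>))"
    using eq by simp
  also have "\<dots> = (\<integral>\<^sup>+r. \<integral>\<^sup>+w. h (r *\<^sub>R w) \<partial>?\<sigma> \<partial>?R)"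
    using \<sigma>.nn_integral_fst[OF hm] by simp
  also have "\<dots> = (\<integral>\<^sup>+r. ennreal (r ^ (DIM('a) - 1)) * \<integral>\<^sup>+w. h (r *\<^sub>R w) \<partial>?\<sigma> \<partial>?L)"
    using \<sigma>.borel_measurable_nn_integral_fst[OF hm] by (subst nn_integral_density) auto
  also have "\<dots> = (\<integral>\<^sup>+r. \<integral>\<^sup>+w. ennreal (r ^ (DIM('a) - 1)) * h (r *\<^sub>R w) \<partial>?\<sigma> \<partial>?L)"
    using hw by (simp add: nn_integral_cmult)
  finally show ?thesis .
qed

section \<open>The limiting tail measure\<close>

text \<open>These properties of the limit density carry every statement about \<nu>. The density
  \<open>f\<close> of \<xi> is kept out, so that \<xi> and the family compared with it can be
  treated by the same lemmas.\<close>

locale homogeneous_tail =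
  fixes E :: "'a::euclidean_space set" and s :: real and \<phi> :: "'a \<Rightarrow> real"
  assumes closed_E: "closed E" and cone_E: "cone E" and E_nonempty: "E \<noteq> {}" and s_pos: "0 < s"
    and continuous_\<phi>: "continuous_on (E - {0}) \<phi>"
    and \<phi>_pos: "z \<in> E - {0} \<Longrightarrow> 0 < \<phi> z"
    and \<phi>_scaleR: "z \<in> E - {0} \<Longrightarrow> 0 < c \<Longrightarrow> \<phi> (c *\<^sub>R z) = c powr - (s + DIM('a)) * \<phi> z"
begin

abbreviation "\<nu> \<equiv> limit_tail_measure E s \<phi>"
abbreviation "punctured \<equiv> restrict_space borel (E - {0})"

lemma zero_in_E: "0 \<in> E"
  using cone_contains_0[OF cone_E] E_nonempty by simp

lemma E_borel [measurable]: "E \<in> sets borel" "E - {0} \<in> sets borel"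
  using closed_E by auto

lemma sets_punctured: "B \<in> sets punctured \<longleftrightarrow> B \<in> sets borel \<and> B \<subseteq> E - {0}"
  using E_borel by (auto simp: sets_restrict_space_iff)

lemma sets_\<nu>: "sets \<nu> = sets punctured"
  by (simp add: limit_tail_measure_def)

lemma borel_measurable_\<phi> [measurable]: "(\<lambda>z. ennreal (\<phi> z) * indicator (E - {0}) z) \<in> borel_measurable borel"
proof -
  have "\<phi> \<in> borel_measurable punctured"
    using continuous_\<phi> by (rule borel_measurable_continuous_on_restrict)
  then have "(\<lambda>z. ennreal (\<phi> z)) \<in> borel_measurable punctured" by simp
  then show ?thesis
    using E_borel by (subst (asm) borel_measurable_restrict_space_iff_ennreal) auto
qed

lemma borel_measurable_\<phi>_indicator:
  assumes "B \<in> sets punctured"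
  shows "(\<lambda>z. ennreal (\<phi> z) * indicator B z) \<in> borel_measurable borel"
proof -
  have [measurable]: "B \<in> sets borel" using assms sets_punctured by auto
  have "(\<lambda>z. ennreal (\<phi> z) * indicator B z)
      = (\<lambda>z. ennreal (\<phi> z) * indicator (E - {0}) z * indicator B z)"
    using assms sets_punctured by (auto simp: fun_eq_iff indicator_def)
  then show ?thesis by simp
qed

text \<open>The Jacobian r^(d-1) times the homogeneity factor r^-(s+d) is r^-(s+1), exactly the
  radial weight in \<open>limit_tail_measure\<close>.\<close>

lemma nn_integral_\<phi>_polar:
  assumes B: "B \<in> sets punctured"
  shows "(\<integral>\<^sup>+z. ennreal (\<phi> z) * indicator B z \<partial>lborel) =
    (\<integral>\<^sup>+r. \<integral>\<^sup>+w. ennreal (r powr (- (s + 1)) * \<phi> w) * indicator B (r *\<^sub>R w)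
      \<partial>surface_measure E \<partial>restrict_space lborel {0<..})"
proof -
  have "(\<integral>\<^sup>+z. ennreal (\<phi> z) * indicator B z \<partial>lborel)
      = (\<integral>\<^sup>+z. (ennreal (\<phi> z) * indicator B z) * indicator (E - {0}) z \<partial>lborel)"
    using B sets_punctured by (auto intro!: nn_integral_cong simp: indicator_def)
  also have "\<dots> = (\<integral>\<^sup>+r. \<integral>\<^sup>+w. ennreal (r ^ (DIM('a) - 1)) *
      (ennreal (\<phi> (r *\<^sub>R w)) * indicator B (r *\<^sub>R w)) \<partial>surface_measure E \<partial>restrict_space lborel {0<..})"
    by (rule nn_integral_polar[OF closed_E cone_E borel_measurable_\<phi>_indicator[OF B]])
  also have "\<dots> = (\<integral>\<^sup>+r. \<integral>\<^sup>+w. ennreal (r powr (- (s + 1)) * \<phi> w) * indicator B (r *\<^sub>R w)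
      \<partial>surface_measure E \<partial>restrict_space lborel {0<..})"
  proof (intro nn_integral_cong)
    fix r w assume "r \<in> space (restrict_space lborel {0::real<..})" and w: "w \<in> space (surface_measure E)"
    then have r: "0 < r" by (simp add: space_restrict_space)
    have w': "w \<in> E - {0}" using w by (auto simp: sphere_part_def)
    have "r ^ (DIM('a) - 1) = r powr (real DIM('a) - 1)"
      using r DIM_positive[where 'a='a] by (simp add: powr_realpow[symmetric] of_nat_diff)
    then have "r ^ (DIM('a) - 1) * (r powr - (s + DIM('a)) * \<phi> w) = r powr (- (s + 1)) * \<phi> w"
      using r by (simp add: mult.assoc[symmetric] powr_add[symmetric] add.commute)
    then show "ennreal (r ^ (DIM('a) - 1)) * (ennreal (\<phi> (r *\<^sub>R w)) * indicator B (r *\<^sub>R w))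
      = ennreal (r powr (- (s + 1)) * \<phi> w) * indicator B (r *\<^sub>R w)"
      using r w' \<phi>_pos[of w] \<phi>_scaleR[OF w' r]
      by (simp add: mult.assoc[symmetric] ennreal_mult[symmetric] less_imp_le)
  qed
  finally show ?thesis .
qed

lemma emeasure_\<nu>:
  assumes B: "B \<in> sets punctured"
  shows "emeasure \<nu> B = (\<integral>\<^sup>+z. ennreal (\<phi> z) * indicator B z \<partial>lborel)"
proof -
  let ?\<sigma> = "surface_measure E" and ?L = "restrict_space lborel {0::real<..}"
  let ?f = "\<lambda>(r, w). ennreal (r powr (- (s + 1)) * \<phi> w)" and ?T = "\<lambda>(r, w). r *\<^sub>R w :: 'a"
  interpret \<sigma>: finite_measure ?\<sigma> by (rule finite_measure_surface_measure[OF closed_E cone_E])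
  have idL: "(\<lambda>r. r) \<in> ?L \<rightarrow>\<^sub>M borel"
    by (intro measurable_restrict_space1) simp
  have id\<sigma>: "(\<lambda>w. w) \<in> ?\<sigma> \<rightarrow>\<^sub>M borel"
    unfolding measurable_cong_sets[OF sets_surface_measure refl]
    by (intro measurable_restrict_space1) simp
  have \<phi>\<sigma>: "\<phi> \<in> borel_measurable ?\<sigma>"
    unfolding measurable_cong_sets[OF sets_surface_measure refl]
    by (intro borel_measurable_continuous_on_restrict continuous_on_subset[OF continuous_\<phi>])
       (auto simp: sphere_part_def)
  note [measurable] = measurable_compose[OF measurable_fst idL] measurable_compose[OF measurable_snd id\<sigma>]
    measurable_compose[OF measurable_snd \<phi>\<sigma>]
  have T: "?T \<in> ?L \<Otimes>\<^sub>M ?\<sigma> \<rightarrow>\<^sub>M punctured"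
  proof (rule measurable_restrict_space2)
    show "?T \<in> space (?L \<Otimes>\<^sub>M ?\<sigma>) \<rightarrow> E - {0}"
      using mem_cone[OF cone_E] by (auto simp: space_pair_measure space_restrict_space sphere_part_def)
    show "?T \<in> ?L \<Otimes>\<^sub>M ?\<sigma> \<rightarrow>\<^sub>M borel"
      unfolding split_beta by measurable
  qed
  have f[measurable]: "?f \<in> borel_measurable (?L \<Otimes>\<^sub>M ?\<sigma>)"
    unfolding split_beta by measurable
  have B'[measurable]: "?T -` B \<inter> space (?L \<Otimes>\<^sub>M ?\<sigma>) \<in> sets (?L \<Otimes>\<^sub>M ?\<sigma>)"
    using measurable_sets[OF T B] .
  have "emeasure \<nu> B = emeasure (density (?L \<Otimes>\<^sub>M ?\<sigma>) ?f) (?T -` B \<inter> space (?L \<Otimes>\<^sub>M ?\<sigma>))"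
    unfolding limit_tail_measure_def using T B by (subst emeasure_distr) auto
  also have "\<dots> = (\<integral>\<^sup>+p. ?f p * indicator (?T -` B \<inter> space (?L \<Otimes>\<^sub>M ?\<sigma>)) p \<partial>(?L \<Otimes>\<^sub>M ?\<sigma>))"
    by (rule emeasure_density[OF f B'])
  also have "\<dots> = (\<integral>\<^sup>+r. \<integral>\<^sup>+w. ?f (r, w) * indicator (?T -` B \<inter> space (?L \<Otimes>\<^sub>M ?\<sigma>)) (r, w) \<partial>?\<sigma> \<partial>?L)"
    by (rule \<sigma>.nn_integral_fst[symmetric]) measurable
  also have "\<dots> = (\<integral>\<^sup>+r. \<integral>\<^sup>+w. ennreal (r powr (- (s + 1)) * \<phi> w) * indicator B (r *\<^sub>R w) \<partial>?\<sigma> \<partial>?L)"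
    by (intro nn_integral_cong) (auto simp: indicator_def space_pair_measure)
  finally show ?thesis using nn_integral_\<phi>_polar[OF B] by simp
qed

text \<open>Substituting c z contributes c^d from Lebesgue measure and c^-(s+d) from
  \<open>\<phi>\<close>. The relation between \<open>B'\<close> and its preimage \<open>B\<close>
  under dilation is given pointwise on \<open>E\<close>, which suits sets described by
  inequalities.\<close>

lemma emeasure_\<nu>_scale:
  assumes B: "B \<in> sets punctured" "B' \<in> sets punctured" and c: "0 < c"
    and eq: "\<And>z. z \<in> E \<Longrightarrow> c *\<^sub>R z \<in> B' \<longleftrightarrow> z \<in> B"
  shows "emeasure \<nu> B' = ennreal (c powr - s) * emeasure \<nu> B"
proof -
  have "emeasure \<nu> B' = ennreal (c ^ DIM('a)) *
      (\<integral>\<^sup>+z. ennreal (\<phi> (c *\<^sub>R z)) * indicator B' (c *\<^sub>R z) \<partial>lborel)"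
    unfolding emeasure_\<nu>[OF B(2)]
    by (rule nn_integral_lborel_scaleR[OF borel_measurable_\<phi>_indicator[OF B(2)] c])
  also have "(\<integral>\<^sup>+z. ennreal (\<phi> (c *\<^sub>R z)) * indicator B' (c *\<^sub>R z) \<partial>lborel)
     = (\<integral>\<^sup>+z. ennreal (c powr - (s + DIM('a))) * (ennreal (\<phi> z) * indicator B z) \<partial>lborel)"
  proof (intro nn_integral_cong)
    fix z
    have "c *\<^sub>R z \<in> B' \<longleftrightarrow> z \<in> B"
      using B eq cone_scaleR_iff[OF cone_E c, of z] sets_punctured by (cases "z \<in> E") auto
    then show "ennreal (\<phi> (c *\<^sub>R z)) * indicator B' (c *\<^sub>R z) =
      ennreal (c powr - (s + DIM('a))) * (ennreal (\<phi> z) * indicator B z)"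
      using B(1) sets_punctured \<phi>_scaleR[OF _ c, of z] \<phi>_pos[of z]
      by (auto simp: indicator_def ennreal_mult less_imp_le subset_iff)
  qed
  also have "\<dots> = ennreal (c powr - (s + DIM('a))) * emeasure \<nu> B"
    using borel_measurable_\<phi>_indicator[OF B(1)] by (simp add: nn_integral_cmult emeasure_\<nu>[OF B(1)])
  finally show ?thesis
    using c by (simp add: mult.assoc[symmetric] ennreal_mult[symmetric] powr_realpow[symmetric] powr_add[symmetric])
qed

lemma far_sets:
  "{z \<in> E - {0}. r < norm z} \<in> sets punctured" "{z \<in> E - {0}. r \<le> norm z} \<in> sets punctured"
  unfolding sets_punctured by auto

declare far_sets [simp] far_sets [unfolded Diff_iff singleton_iff conj_assoc, simp]

text \<open>By continuity \<open>\<phi>\<close> is bounded on the compact sphere part, the surface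
  measure is finite, and the radial weight q^-(s+1) has the finite integral r^-s / s over [r,
  \<infinity>) because s > 0.\<close>

lemma emeasure_\<nu>_far_finite:
  assumes "0 < r"
  shows "emeasure \<nu> {z \<in> E - {0}. r \<le> norm z} < \<infinity>"
proof -
  let ?\<sigma> = "surface_measure E"
  interpret \<sigma>: finite_measure ?\<sigma> by (rule finite_measure_surface_measure[OF closed_E cone_E])
  have "compact (sphere_part E)" by (rule compact_sphere_part[OF closed_E])
  moreover have "continuous_on (sphere_part E) \<phi>"
    by (rule continuous_on_subset[OF continuous_\<phi>]) (auto simp: sphere_part_def)
  ultimately have "bounded (\<phi> ` sphere_part E)"
    using compact_continuous_image compact_imp_bounded by blast
  then obtain C where C: "\<And>w. w \<in> sphere_part E \<Longrightarrow> \<phi> w \<le> C" and "0 < C"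
    unfolding bounded_pos by (force simp: abs_le_iff)
  have "emeasure \<nu> {z \<in> E - {0}. r \<le> norm z} =
    (\<integral>\<^sup>+q. \<integral>\<^sup>+w. ennreal (q powr (- (s + 1)) * \<phi> w) * indicator {z \<in> E - {0}. r \<le> norm z} (q *\<^sub>R w)
      \<partial>?\<sigma> \<partial>restrict_space lborel {0<..})"
    by (simp add: emeasure_\<nu> nn_integral_\<phi>_polar)
  also have "\<dots> \<le> (\<integral>\<^sup>+q. \<integral>\<^sup>+w. ennreal (C * q powr (- (s + 1))) * indicator {r..} q
      \<partial>?\<sigma> \<partial>restrict_space lborel {0<..})"
    using C \<open>0 < C\<close>
    by (intro nn_integral_mono)
       (auto simp: space_restrict_space indicator_def sphere_part_def mult.commute intro!: ennreal_leI mult_left_mono)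
  also have "\<dots> = (\<integral>\<^sup>+q. emeasure ?\<sigma> (sphere_part E) * (ennreal (C * q powr (- (s + 1))) * indicator {r..} q)
     \<partial>lborel)"
    using assms
    by (auto simp: nn_integral_restrict_space mult.commute indicator_def intro!: nn_integral_cong)
  also have "\<dots> = emeasure ?\<sigma> (sphere_part E) * (\<integral>\<^sup>+q. ennreal (C * q powr (- (s + 1))) * indicator {r..} q \<partial>lborel)"
    by (rule nn_integral_cmult) measurable
  also have "(\<integral>\<^sup>+q. ennreal (C * q powr (- (s + 1))) * indicator {r..} q \<partial>lborel)
      = ennreal (0 - (- C / s * r powr - s))"
  proof (rule nn_integral_FTC_atLeast)
    show "((\<lambda>q. - C / s * q powr - s) \<longlongrightarrow> 0) at_top"
      by (intro tendsto_mult_right_zero tendsto_neg_powr filterlim_ident) (use s_pos in simp)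
    show "DERIV (\<lambda>q. - C / s * q powr - s) q :> C * q powr (- (s + 1))" if "r \<le> q" for q
      using that assms s_pos
      by (auto intro!: derivative_eq_intros simp: field_simps powr_diff powr_minus powr_add)
  qed (use \<open>0 < C\<close> in auto)
  finally show ?thesis
    using \<sigma>.emeasure_finite[of "sphere_part E"]
    by (auto simp: less_top[symmetric] ennreal_mult_eq_top_iff top_unique)
qed

lemma \<nu>_in_M0: "\<nu> \<in> M0 E"
  unfolding M0_def
proof (safe)
  fix r :: real assume "0 < r"
  have "emeasure \<nu> {z \<in> E - {0}. r < norm z} \<le> emeasure \<nu> {z \<in> E - {0}. r \<le> norm z}"
    by (rule emeasure_mono) (auto simp: sets_\<nu>)
  then show "emeasure \<nu> {z \<in> E - {0}. r < norm z} < \<infinity>"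
    using emeasure_\<nu>_far_finite[OF \<open>0 < r\<close>] by simp
qed (simp_all add: sets_\<nu>)

text \<open>Strict positivity of \<open>\<phi>\<close> makes \<nu> and Lebesgue measure equivalent
  on \<open>E - {0}\<close>. This translates regularity of a system, a condition on Lebesgue
  measure, into positive \<nu>-mass.\<close>

lemma emeasure_\<nu>_eq_0_iff:
  assumes B: "B \<in> sets punctured"
  shows "emeasure \<nu> B = 0 \<longleftrightarrow> emeasure lborel B = 0"
proof -
  have B': "B \<in> sets borel" "B \<subseteq> E - {0}" using B sets_punctured by auto
  have "emeasure \<nu> B = 0 \<longleftrightarrow> (AE z in lborel. ennreal (\<phi> z) * indicator B z = 0)"
    unfolding emeasure_\<nu>[OF B] using borel_measurable_\<phi>_indicator[OF B]
    by (intro nn_integral_0_iff_AE) auto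
  also have "\<dots> \<longleftrightarrow> (AE z in lborel. z \<notin> B)"
    using B' \<phi>_pos by (intro AE_cong) (force simp: indicator_def)
  also have "\<dots> \<longleftrightarrow> emeasure lborel B = 0"
    using B' by (simp add: AE_iff_measurable[OF _ refl])
  finally show ?thesis .
qed

end

text \<open>The domain is a parameter because there are two kinds of instances: the limits
  \<open>Lstar j\<close>, which are controlled on \<open>E\<close> only, and the explicit test
  functionals of the converse, which live on \<open>UNIV\<close>.\<close>

definition cone_functional :: "'a::real_normed_vector set \<Rightarrow> ('a \<Rightarrow> real) \<Rightarrow> bool" where
  "cone_functional E g \<longleftrightarrow>
     continuous_on E g \<and> (\<forall>z\<in>E. \<forall>c>0. g (c *\<^sub>R z) = c * g z)"

lemma cone_functional_scaleR:
  "cone_functional E g \<Longrightarrow> z \<in> E \<Longrightarrow> 0 < c \<Longrightarrow> g (c *\<^sub>R z) = c * g z"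
  by (simp add: cone_functional_def)

lemma cone_functional_0:
  assumes "cone_functional E g" "0 \<in> E"
  shows "g 0 = 0"
  using cone_functional_scaleR[OF assms, of 2] by simp

section \<open>Exceedance sets of cone functionals under the limiting tail measure\<close>

context homogeneous_tail
begin

context
  fixes G :: "nat \<Rightarrow> 'a \<Rightarrow> real" and J :: "nat set"
  assumes G: "\<And>j. j \<in> J \<Longrightarrow> cone_functional E (G j)" and J: "finite J" "J \<noteq> {}"
begin

lemma joint_exceedance_closed: "closed (joint_exceedance E G c J)"
proof -
  have "joint_exceedance E G c J = (\<Inter>j\<in>J. {z \<in> E. c \<le> G j z})"
    using J by (auto simp: joint_exceedance_def)
  moreover have "closed {z \<in> E. c \<le> G j z}" if "j \<in> J" for j
    using continuous_closed_preimage[of E "G j" "{c..}"] G[OF that] closed_E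
    by (simp add: cone_functional_def vimage_def Int_def)
  ultimately show ?thesis by auto
qed

text \<open>Homogeneity with factor 2 gives \<open>G j 0 = 0\<close>, and one index of the nonempty
  \<open>J\<close> is enough to exclude the origin.\<close>

lemma zero_notin_joint_exceedance: "0 < c \<Longrightarrow> 0 \<notin> joint_exceedance E G c J"
  using J cone_functional_0[OF G] by (force simp: joint_exceedance_def)

lemma joint_exceedance_sets:
  assumes "0 < c"
  shows "joint_exceedance E G c J \<in> sets punctured"
  unfolding sets_punctured
proof
  show "joint_exceedance E G c J \<in> sets borel" by (rule borel_closed[OF joint_exceedance_closed])
  show "joint_exceedance E G c J \<subseteq> E - {0}"
    using zero_notin_joint_exceedance[OF assms] by (auto simp: joint_exceedance_def)
qed

lemma joint_exceedance_far:
  assumes "0 < c"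
  obtains r where "0 < r" "joint_exceedance E G c J \<subseteq> {z \<in> E - {0}. r \<le> norm z}"
proof -
  have "open (- joint_exceedance E G c J)" "0 \<in> - joint_exceedance E G c J"
    using joint_exceedance_closed zero_notin_joint_exceedance[OF assms] by auto
  then obtain r where r: "0 < r" "ball 0 r \<subseteq> - joint_exceedance E G c J"
    by (meson open_contains_ball)
  then have "joint_exceedance E G c J \<subseteq> {z \<in> E - {0}. r \<le> norm z}"
    using zero_notin_joint_exceedance[OF assms] by (force simp: joint_exceedance_def subset_iff not_less[symmetric])
  then show thesis using r that by blast
qed

lemma emeasure_joint_exceedance_finite: "0 < c \<Longrightarrow> emeasure \<nu> (joint_exceedance E G c J) < \<infinity>"
proof -
  assume "0 < c"
  then obtain r where r: "0 < r" "joint_exceedance E G c J \<subseteq> {z \<in> E - {0}. r \<le> norm z}"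
    by (rule joint_exceedance_far)
  then have "emeasure \<nu> (joint_exceedance E G c J) \<le> emeasure \<nu> {z \<in> E - {0}. r \<le> norm z}"
    by (intro emeasure_mono) (auto simp: sets_\<nu>)
  then show ?thesis using emeasure_\<nu>_far_finite[OF r(1)] by simp
qed

lemma emeasure_joint_exceedance_scale:
  assumes "0 < c"
  shows "emeasure \<nu> (joint_exceedance E G c J) = ennreal (c powr - s) * emeasure \<nu> (joint_exceedance E G 1 J)"
proof (rule emeasure_\<nu>_scale[OF joint_exceedance_sets joint_exceedance_sets assms])
  fix z assume z: "z \<in> E"
  have "c \<le> G j (c *\<^sub>R z) \<longleftrightarrow> 1 \<le> G j z" if "j \<in> J" for j
  proof -
    have "G j (c *\<^sub>R z) = c * G j z" using G[OF that] z assms by (simp add: cone_functional_def)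
    then show ?thesis using assms by simp
  qed
  then show "c *\<^sub>R z \<in> joint_exceedance E G c J \<longleftrightarrow> z \<in> joint_exceedance E G 1 J"
    using z cone_scaleR_iff[OF cone_E assms] by (simp add: joint_exceedance_def)
qed (use assms in simp_all)

text \<open>The strict set contains the exceedance sets at the levels c = 1 + 1/(n+1), whose masses
  are c^-s times the finite mass at level 1. Letting c decrease to 1 leaves no room for mass on the
  boundary. Relative openness is what later places the strict set inside the interior.\<close>

lemma emeasure_strict_exceedance:
  "emeasure \<nu> {z \<in> E - {0}. \<forall>j\<in>J. 1 < G j z} = emeasure \<nu> (joint_exceedance E G 1 J)" (is "emeasure \<nu> ?U = _")
  "{z \<in> E - {0}. \<forall>j\<in>J. 1 < G j z} \<in> sets punctured"
  "openin (top_of_set (E - {0})) {z \<in> E - {0}. \<forall>j\<in>J. 1 < G j z}"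
proof -
  have U_eq: "?U = (\<Inter>j\<in>J. {z \<in> E - {0}. 1 < G j z})"
    using J(2) by blast
  have "openin (top_of_set (E - {0})) {z \<in> E - {0}. 1 < G j z}" if "j \<in> J" for j
  proof -
    have "continuous_on (E - {0}) (G j)"
      using G[OF that] by (auto simp: cone_functional_def intro: continuous_on_subset)
    from continuous_openin_preimage_gen[OF this, of "{1<..}"]
    show ?thesis by (simp add: vimage_def Int_def)
  qed
  then show op: "openin (top_of_set (E - {0})) ?U"
    using J by (simp only: U_eq) (rule openin_Inter, auto)
  then show U: "?U \<in> sets punctured"
    using borel_open by (fastforce simp: openin_open sets_restrict_space)
  show "emeasure \<nu> ?U = emeasure \<nu> (joint_exceedance E G 1 J)"
  proof (rule antisym)
    show "emeasure \<nu> ?U \<le> emeasure \<nu> (joint_exceedance E G 1 J)"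
      using joint_exceedance_sets[of 1]
      by (intro emeasure_mono) (auto simp: joint_exceedance_def sets_\<nu> less_imp_le)
    have "(\<lambda>n. (1 + 1 / Suc n) powr - s) \<longlonglongrightarrow> (1 + 0) powr - s"
      by (intro tendsto_powr tendsto_add tendsto_const LIMSEQ_Suc[OF lim_1_over_n]) auto
    then have "(\<lambda>n. emeasure \<nu> (joint_exceedance E G 1 J) * ennreal ((1 + 1 / Suc n) powr - s))
        \<longlonglongrightarrow> emeasure \<nu> (joint_exceedance E G 1 J) * ennreal ((1 + 0) powr - s)"
      using emeasure_joint_exceedance_finite[of 1] by (intro ennreal_tendsto_cmult tendsto_ennrealI) auto
    moreover have "emeasure \<nu> (joint_exceedance E G (1 + 1 / Suc n) J)
        = emeasure \<nu> (joint_exceedance E G 1 J) * ennreal ((1 + 1 / Suc n) powr - s)" for n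
      by (subst emeasure_joint_exceedance_scale) (simp_all only: mult.commute add_pos_nonneg zero_less_one zero_le_divide_1_iff of_nat_0_le_iff)
    ultimately have "(\<lambda>n. emeasure \<nu> (joint_exceedance E G (1 + 1 / Suc n) J)) \<longlonglongrightarrow> emeasure \<nu> (joint_exceedance E G 1 J)"
      by simp
    moreover have "emeasure \<nu> (joint_exceedance E G (1 + 1 / Suc n) J) \<le> emeasure \<nu> ?U" for n
    proof -
      have pos: "0 < 1 + 1 / real (Suc n)" and gt: "1 < 1 + 1 / real (Suc n)"
        by (simp_all add: add_pos_nonneg)
      have "joint_exceedance E G (1 + 1 / Suc n) J \<subseteq> ?U"
      proof
        fix z assume z: "z \<in> joint_exceedance E G (1 + 1 / Suc n) J"
        then have "z \<noteq> 0" using zero_notin_joint_exceedance[OF pos] by blast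
        moreover have "1 < G j z" if "j \<in> J" for j
          using z that gt less_le_trans by (fastforce simp only: joint_exceedance_def mem_Collect_eq)
        ultimately show "z \<in> ?U" using z by (simp add: joint_exceedance_def)
      qed
      then show ?thesis using U by (intro emeasure_mono) (auto simp: sets_\<nu>)
    qed
    ultimately show "emeasure \<nu> (joint_exceedance E G 1 J) \<le> emeasure \<nu> ?U"
      by (intro LIMSEQ_le_const2) auto
  qed
qed

text \<open>The weak exceedance set is relatively closed and its interior contains the strict one,
  so the frontier lies in their difference; the masses are equal and finite, hence the difference is
  null.\<close>

lemma emeasure_frontier_joint_exceedance:
  "emeasure \<nu> (top_of_set (E - {0}) frontier_of joint_exceedance E G 1 J) = 0"
proof -
  let ?X = "top_of_set (E - {0})" and ?T = "joint_exceedance E G 1 J" and ?U = "{z \<in> E - {0}. \<forall>j\<in>J. 1 < G j z}"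
  have "closedin ?X ?T"
    using joint_exceedance_sets[of 1] joint_exceedance_closed[of 1] sets_punctured
    by (auto intro!: closed_subset)
  then have "?X closure_of ?T = ?T" by (rule closure_of_closedin)
  moreover have "?U \<subseteq> ?X interior_of ?T"
    using emeasure_strict_exceedance(3) by (intro interior_of_maximal) (auto simp: joint_exceedance_def)
  ultimately have "?X frontier_of ?T \<subseteq> ?T - ?U"
    by (auto simp: frontier_of_def)
  then have "emeasure \<nu> (?X frontier_of ?T) \<le> emeasure \<nu> (?T - ?U)"
    using joint_exceedance_sets[of 1] emeasure_strict_exceedance(2)
    by (intro emeasure_mono) (auto simp: sets_\<nu>)
  also have "\<dots> = emeasure \<nu> ?T - emeasure \<nu> ?U"
    using joint_exceedance_sets[of 1] emeasure_strict_exceedance(1,2) emeasure_joint_exceedance_finite[of 1]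
    by (intro emeasure_Diff) (auto simp: sets_\<nu> joint_exceedance_def)
  also have "\<dots> = 0"
    using emeasure_strict_exceedance(1) emeasure_joint_exceedance_finite[of 1] by simp
  finally show ?thesis by simp
qed

end

end

section \<open>Regularly varying densities\<close>

lemma density_limit_pointwise:
  assumes "density_regularly_varying E f s \<phi>" "z \<in> E - {0}"
  shows "((\<lambda>t. t powr (s + DIM('a)) * f (t *\<^sub>R z)) \<longlongrightarrow> \<phi> (z::'a::euclidean_space)) at_top"
proof -
  have "uniform_limit {z} (\<lambda>t z. t powr (s + DIM('a)) * f (t *\<^sub>R z)) \<phi> at_top"
    using assms unfolding density_regularly_varying_def by (auto simp del: uniform_limit_singleton)
  then show ?thesis by simp
qed

text \<open>\<open>\<phi>\<close> is a locally uniform limit of continuous functions. Continuity of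
  \<open>f\<close> is known only outside \<open>cball 0 r0\<close>, so near a point z one works on a
  compact piece of the cone away from the origin and waits until t pushes that piece beyond radius
  r0.\<close>

lemma density_limit_continuous:
  fixes E :: "'a::euclidean_space set"
  assumes E: "closed E" "cone E" and rv: "density_regularly_varying E f s \<phi>"
  shows "continuous_on (E - {0}) \<phi>"
proof (subst continuous_on_eq_continuous_within, rule ballI)
  fix z assume z: "z \<in> E - {0}"
  obtain r0 where r0: "r0 > 0" "continuous_on (E - cball 0 r0) f"
    using rv by (auto simp: density_regularly_varying_def)
  define \<rho> where "\<rho> = norm z / 2"
  have \<rho>: "0 < \<rho>" using z by (simp add: \<rho>_def)
  let ?C = "E \<inter> cball z \<rho>"
  have far: "\<rho> \<le> norm y" if "y \<in> ?C" for y
    using that norm_triangle_ineq2[of z "z - y"] by (auto simp: dist_norm \<rho>_def norm_minus_commute)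
  have "compact ?C" using E by auto
  moreover have "?C \<subseteq> E - {0}" using far \<rho> by force
  ultimately have unif: "uniform_limit ?C (\<lambda>t z. t powr (s + DIM('a)) * f (t *\<^sub>R z)) \<phi> at_top"
    using rv unfolding density_regularly_varying_def by blast
  have "\<forall>\<^sub>F t in at_top. continuous_on ?C (\<lambda>z. t powr (s + DIM('a)) * f (t *\<^sub>R z))"
    using eventually_gt_at_top[of "r0 / \<rho>"]
  proof eventually_elim
    case (elim t)
    have "0 < r0 / \<rho>" using r0 \<rho> by simp
    with elim have t: "0 < t" by linarith
    have "(*\<^sub>R) t ` ?C \<subseteq> E - cball 0 r0"
    proof safe
      fix y assume y: "y \<in> E" "y \<in> cball z \<rho>"
      show "t *\<^sub>R y \<in> E" using y t E(2) by (intro mem_cone) auto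
      have "r0 < t * \<rho>" using elim \<rho> by (simp add: field_simps)
      also have "\<dots> \<le> t * norm y" using far[of y] y t by (intro mult_left_mono) auto
      finally show "t *\<^sub>R y \<in> cball 0 r0 \<Longrightarrow> False" using t by auto
    qed
    then have "continuous_on ?C (\<lambda>y. f (t *\<^sub>R y))"
      by (intro continuous_on_compose2[OF r0(2)] continuous_intros)
    then show ?case by (intro continuous_intros)
  qed
  then have "continuous_on ?C \<phi>"
    using unif by (intro uniform_limit_theorem) auto
  then have "continuous (at z within ?C) \<phi>"
    using z \<rho> by (auto simp: continuous_on_eq_continuous_within)
  moreover have "at z within ?C = at z within (E - {0})"
    using \<rho> far by (intro at_within_nhd[of z "ball z \<rho>"]) force+
  ultimately show "continuous (at z within (E - {0})) \<phi>" by simp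
qed

text \<open>Running the limit for z along t c instead of t gives c^(s+d) times the limit for c z,
  and limits are unique.\<close>

lemma density_limit_scaleR:
  fixes E :: "'a::euclidean_space set"
  assumes E: "cone E" and rv: "density_regularly_varying E f s \<phi>" and z: "z \<in> E - {0}" and c: "0 < c"
  shows "\<phi> (c *\<^sub>R z) = c powr - (s + DIM('a)) * \<phi> z"
proof -
  let ?p = "s + DIM('a)"
  have cz: "c *\<^sub>R z \<in> E - {0}" using z c cone_scaleR_iff[OF E c] by auto
  have "((\<lambda>t. (t * c) powr ?p * f ((t * c) *\<^sub>R z)) \<longlongrightarrow> \<phi> z) at_top"
    using c by (intro filterlim_compose[OF density_limit_pointwise[OF rv z]]
        filterlim_at_top_mult_tendsto_pos[OF tendsto_const _ filterlim_ident])
  moreover have "\<forall>\<^sub>F t in at_top. (t * c) powr ?p * f ((t * c) *\<^sub>R z)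
      = c powr ?p * (t powr ?p * f (t *\<^sub>R (c *\<^sub>R z)))"
    using eventually_gt_at_top[of 0] by eventually_elim (use c in \<open>simp add: powr_mult\<close>)
  ultimately have "((\<lambda>t. c powr ?p * (t powr ?p * f (t *\<^sub>R (c *\<^sub>R z)))) \<longlongrightarrow> \<phi> z) at_top"
    by (rule Lim_transform_eventually)
  moreover have "((\<lambda>t. c powr ?p * (t powr ?p * f (t *\<^sub>R (c *\<^sub>R z)))) \<longlongrightarrow> c powr ?p * \<phi> (c *\<^sub>R z)) at_top"
    by (intro tendsto_mult_left density_limit_pointwise[OF rv cz])
  ultimately have "\<phi> z = c powr ?p * \<phi> (c *\<^sub>R z)"
    by (intro tendsto_unique[OF trivial_limit_at_top_linorder])
  then show ?thesis using c by (simp add: mult.assoc[symmetric] powr_add[symmetric])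
qed

lemma homogeneous_tail_of_density:
  fixes E :: "'a::euclidean_space set"
  assumes "closed E" "cone E" "E \<noteq> {}" "density_regularly_varying E f s \<phi>"
  shows "homogeneous_tail E s \<phi>"
proof
  show "0 < s" "\<And>z. z \<in> E - {0} \<Longrightarrow> 0 < \<phi> z"
    using assms(4) by (auto simp: density_regularly_varying_def)
qed (use assms density_limit_continuous density_limit_scaleR in blast)+

section \<open>Scaled laws and dominated convergence of the rescaled density\<close>

context homogeneous_tail
begin

lemma emeasure_scaled_law:
  assumes X: "X u \<in> borel_measurable (N u)" and B: "B \<in> sets punctured"
  shows "emeasure (scaled_law E s N X u) B
    = ennreal (u powr s) * emeasure (N u) {\<omega> \<in> space (N u). X u \<omega> /\<^sub>R u \<in> B}"
proof -
  have "B \<in> sets borel" "B \<subseteq> E - {0}" using B sets_punctured by auto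
  then have "emeasure (restrict_space (distr (N u) borel (\<lambda>\<omega>. X u \<omega> /\<^sub>R u)) (E - {0})) B
    = emeasure (distr (N u) borel (\<lambda>\<omega>. X u \<omega> /\<^sub>R u)) B"
    using E_borel by (intro emeasure_restrict_space) auto
  also have "\<dots> = emeasure (N u) {\<omega> \<in> space (N u). X u \<omega> /\<^sub>R u \<in> B}"
    using X \<open>B \<in> sets borel\<close> by (subst emeasure_distr) (auto intro!: arg_cong[where f="emeasure _"])
  finally show ?thesis by (simp add: scaled_law_def)
qed

lemma scaled_law_in_M0:
  assumes "prob_space (N u)" and X: "X u \<in> borel_measurable (N u)"
  shows "scaled_law E s N X u \<in> M0 E"
proof -
  interpret prob_space "N u" by fact
  have "sets (scaled_law E s N X u) = sets punctured"
    by (simp add: scaled_law_def sets_restrict_space)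
  moreover have "emeasure (scaled_law E s N X u) {z \<in> E - {0}. r < norm z} < \<infinity>" for r
    unfolding emeasure_scaled_law[of X u N, OF X far_sets(1)] by (simp add: less_top[symmetric] ennreal_mult_eq_top_iff)
  ultimately show ?thesis by (simp add: M0_def)
qed

text \<open>The majorant is 2 \<open>\<phi>\<close>. Uniform convergence on the unit sphere bounds
  the rescaled density there by 2 \<open>\<phi>\<close> for large t, and homogeneity carries this
  bound to every z with norm at least r, by reading u z as the point at radius u norm z in direction
  \<open>sgn z\<close>.\<close>

lemma scaled_density_tendsto:
  assumes rv: "density_regularly_varying E f s \<phi>" and f: "\<And>z. 0 \<le> f z"
    and fm: "(\<lambda>z. ennreal (f z)) \<in> borel_measurable borel"
    and B: "B \<in> sets punctured" and r: "0 < r" "B \<subseteq> {z \<in> E - {0}. r \<le> norm z}"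
  shows "((\<lambda>u. \<integral>\<^sup>+z. ennreal (u powr (s + DIM('a)) * f (u *\<^sub>R z)) * indicator B z \<partial>lborel)
    \<longlongrightarrow> emeasure \<nu> B) at_top"
proof -
  let ?p = "s + DIM('a)"
  have Bb: "B \<in> sets borel" "B \<subseteq> E - {0}" using B sets_punctured by auto
  have sphere: "compact (sphere_part E)" "sphere_part E \<subseteq> E - {0}"
    using closed_E compact_sphere_part by (auto simp: sphere_part_def)
  \<comment> \<open>A positive lower bound of \<open>\<phi>\<close> on the sphere part, used as the
    uniform error, so that \<open>\<phi> w + c \<le> 2 * \<phi> w\<close>. If the sphere part is
    empty, any positive number serves.\<close>
  obtain c where c: "0 < c" "\<And>w. w \<in> sphere_part E \<Longrightarrow> c \<le> \<phi> w"
  proof (cases "sphere_part E = {}")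
    case True
    then show ?thesis using that[of 1] by auto
  next
    case False
    then obtain w where "w \<in> sphere_part E" "\<And>y. y \<in> sphere_part E \<Longrightarrow> \<phi> w \<le> \<phi> y"
      using continuous_attains_inf[OF sphere(1) _ continuous_on_subset[OF continuous_\<phi> sphere(2)]] by blast
    then show ?thesis using that[of "\<phi> w"] sphere(2) \<phi>_pos[of w] by auto
  qed
  have "uniform_limit (sphere_part E) (\<lambda>t z. t powr ?p * f (t *\<^sub>R z)) \<phi> at_top"
    using rv sphere unfolding density_regularly_varying_def by blast
  then have "\<forall>\<^sub>F t in at_top. \<forall>w\<in>sphere_part E. dist (t powr ?p * f (t *\<^sub>R w)) (\<phi> w) < c"
    using c(1) by (rule uniform_limitD)
  then obtain T0 where T0: "\<And>t w. T0 \<le> t \<Longrightarrow> w \<in> sphere_part E \<Longrightarrow> dist (t powr ?p * f (t *\<^sub>R w)) (\<phi> w) < c"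
    by (auto simp: eventually_at_top_linorder)
  \<comment> \<open>Dividing by r ensures that u norm z reaches T0 for every z in \<open>B\<close>;
    the 1 in the maximum forces u > 0.\<close>
  have bound: "u powr ?p * f (u *\<^sub>R z) \<le> 2 * \<phi> z"
    if z: "z \<in> B" and u: "max 1 T0 / r \<le> u" for u z
  proof -
    have zE: "z \<in> E - {0}" "r \<le> norm z" using z r by auto
    have u0: "0 < u" using u r by (smt (verit) divide_pos_pos max.cobounded1)
    have nz: "0 < norm z" using zE by simp
    have "max 1 T0 \<le> u * r" using u r by (simp add: field_simps)
    also have "\<dots> \<le> u * norm z" using zE u0 by simp
    finally have T: "T0 \<le> u * norm z" by simp
    have w: "sgn z \<in> sphere_part E"
      using zE by (auto simp: sphere_part_def norm_sgn cone_sgn_iff[OF cone_E])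
    have "(u * norm z) powr ?p * f ((u * norm z) *\<^sub>R sgn z) \<le> \<phi> (sgn z) + c"
      using T0[OF T w] by (simp add: dist_real_def)
    also have "\<dots> \<le> 2 * \<phi> (sgn z)" using c(2)[OF w] by simp
    finally have "norm z powr ?p * (u powr ?p * f (u *\<^sub>R z)) \<le> 2 * \<phi> (sgn z)"
      using u0 nz by (simp add: powr_mult sgn_div_norm mult_ac)
    also have "\<phi> (sgn z) = norm z powr ?p * \<phi> z"
    proof -
      have "\<phi> z = norm z powr - ?p * \<phi> (sgn z)"
        using \<phi>_scaleR[OF subsetD[OF sphere(2) w] nz] zE by (simp add: sgn_div_norm)
      then show ?thesis using nz by (simp add: mult.assoc[symmetric] powr_add[symmetric])
    qed
    finally have "norm z powr ?p * (u powr ?p * f (u *\<^sub>R z)) \<le> norm z powr ?p * (2 * \<phi> z)"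
      by (simp add: mult_ac)
    then show ?thesis using nz by simp
  qed
  note [measurable] = fm
  show ?thesis
  proof (rule tendsto_at_topI_sequentially)
    fix t :: "nat \<Rightarrow> real" assume t: "filterlim t at_top sequentially"
    then have "\<forall>\<^sub>F n in sequentially. max 1 T0 / r \<le> t n"
      by (simp add: filterlim_at_top)
    \<comment> \<open>Dominated convergence requires the bound at every index, so the sequence is
      shifted by k; \<open>LIMSEQ_offset\<close> undoes the shift at the end.\<close>
    then obtain k where "\<forall>n\<ge>k. max 1 T0 / r \<le> t n"
      unfolding eventually_sequentially by blast
    then have k: "max 1 T0 / r \<le> t (n + k)" for n by simp
    let ?u = "\<lambda>n z. ennreal (t (n + k) powr ?p * f (t (n + k) *\<^sub>R z)) * indicator B z"
    have "(\<lambda>n. \<integral>\<^sup>+z. ?u n z \<partial>lborel) \<longlonglongrightarrow> (\<integral>\<^sup>+z. ennreal (\<phi> z) * indicator B z \<partial>lborel)"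
    proof (rule nn_integral_dominated_convergence)
      show "?u n \<in> borel_measurable lborel" for n
        using f Bb(1) by (simp add: ennreal_mult)
      show "(\<lambda>z. ennreal (\<phi> z) * indicator B z) \<in> borel_measurable lborel"
        "(\<lambda>z. 2 * (ennreal (\<phi> z) * indicator B z)) \<in> borel_measurable lborel"
        using borel_measurable_\<phi>_indicator[OF B] by auto
      have "emeasure \<nu> B \<le> emeasure \<nu> {z \<in> E - {0}. r \<le> norm z}"
        using r by (intro emeasure_mono) (auto simp: sets_\<nu>)
      then have "emeasure \<nu> B < \<infinity>" using emeasure_\<nu>_far_finite[OF r(1)] by simp
      then show "(\<integral>\<^sup>+z. 2 * (ennreal (\<phi> z) * indicator B z) \<partial>lborel) < \<infinity>"
        using borel_measurable_\<phi>_indicator[OF B]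
        by (simp add: nn_integral_cmult emeasure_\<nu>[OF B] ennreal_mult_less_top)
      show "AE z in lborel. ?u n z \<le> 2 * (ennreal (\<phi> z) * indicator B z)" for n
      proof (rule AE_I2)
        fix z
        show "?u n z \<le> 2 * (ennreal (\<phi> z) * indicator B z)"
        proof (cases "z \<in> B")
          case True
          have "ennreal (t (n + k) powr ?p * f (t (n + k) *\<^sub>R z)) \<le> ennreal (2 * \<phi> z)"
            by (rule ennreal_leI[OF bound[OF True k]])
          moreover have "0 < \<phi> z" using True Bb(2) by (intro \<phi>_pos) auto
          ultimately show ?thesis using True by (simp add: ennreal_mult less_imp_le)
        qed simp
      qed
      show "AE z in lborel. (\<lambda>n. ?u n z) \<longlonglongrightarrow> ennreal (\<phi> z) * indicator B z"
      proof (rule AE_I2)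
        fix z
        show "(\<lambda>n. ?u n z) \<longlonglongrightarrow> ennreal (\<phi> z) * indicator B z"
        proof (cases "z \<in> B")
          case True
          then have "((\<lambda>t. t powr ?p * f (t *\<^sub>R z)) \<longlongrightarrow> \<phi> z) at_top"
            using Bb(2) by (intro density_limit_pointwise[OF rv]) auto
          from LIMSEQ_ignore_initial_segment[OF filterlim_compose[OF this t], of k]
          show ?thesis using True by (auto intro: tendsto_ennrealI)
        qed simp
      qed
    qed
    then show "(\<lambda>n. \<integral>\<^sup>+z. ennreal (t n powr ?p * f (t n *\<^sub>R z)) * indicator B z \<partial>lborel) \<longlonglongrightarrow> emeasure \<nu> B"
      unfolding emeasure_\<nu>[OF B, symmetric] by (rule LIMSEQ_offset)
  qed
qed

text \<open>The substitution z -> u z turns the mass of the scaled law into an integral of the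
  rescaled density, since u^s u^d = u^(s+d). With this, every limit statement for tail preserving
  families also applies to \<xi>, viewed as a constant family.\<close>

lemma tail_preserving_self:
  assumes M: "prob_space M" and \<xi>: "distributed M lborel \<xi> (\<lambda>z. ennreal (f z))"
    and f: "\<And>z. 0 \<le> f z" and rv: "density_regularly_varying E f s \<phi>"
  shows "tail_preserving E s \<phi> (\<lambda>_. M) (\<lambda>_. \<xi>)"
  unfolding tail_preserving_def M0_tendsto_def
proof (intro conjI ballI impI)
  have \<xi>m: "\<xi> \<in> borel_measurable M" using distributed_measurable[OF \<xi>] by simp
  have fm[measurable]: "(\<lambda>z. ennreal (f z)) \<in> borel_measurable borel"
    using distributed_borel_measurable[OF \<xi>] by simp
  show "\<forall>\<^sub>F u in at_top. scaled_law E s (\<lambda>_. M) (\<lambda>_. \<xi>) u \<in> M0 E"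
    by (intro always_eventually allI scaled_law_in_M0) (simp_all add: M \<xi>m)
  show "\<nu> \<in> M0 E" by (rule \<nu>_in_M0)
  fix B assume B: "B \<in> sets punctured"
    and "emeasure \<nu> (top_of_set (E - {0}) frontier_of B) = 0 \<and> 0 \<notin> closure B"
  then have "open (- closure B)" "0 \<in> - closure B" by auto
  then obtain r where r: "0 < r" "ball 0 r \<subseteq> - closure B" by (meson open_contains_ball)
  have Bb[measurable]: "B \<in> sets borel" and B': "B \<subseteq> E - {0}" using B sets_punctured by auto
  have Br: "B \<subseteq> {z \<in> E - {0}. r \<le> norm z}"
  proof
    fix z assume "z \<in> B"
    then have "z \<notin> ball 0 r" using r closure_subset[of B] by auto
    with \<open>z \<in> B\<close> B' show "z \<in> {z \<in> E - {0}. r \<le> norm z}" by auto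
  qed
  have eq: "(\<integral>\<^sup>+z. ennreal (u powr (s + DIM('a)) * f (u *\<^sub>R z)) * indicator B z \<partial>lborel)
      = emeasure (scaled_law E s (\<lambda>_. M) (\<lambda>_. \<xi>) u) B" if u: "0 < u" for u
  proof -
    have "emeasure M {\<omega> \<in> space M. \<xi> \<omega> /\<^sub>R u \<in> B} = emeasure M (\<xi> -` {z. z /\<^sub>R u \<in> B} \<inter> space M)"
      by (auto intro!: arg_cong[where f="emeasure _"])
    also have "\<dots> = (\<integral>\<^sup>+z. ennreal (f z) * indicator {z. z /\<^sub>R u \<in> B} z \<partial>lborel)"
      by (rule distributed_emeasure[OF \<xi>]) measurable
    also have "\<dots> = ennreal (u ^ DIM('a)) *
       (\<integral>\<^sup>+z. ennreal (f (u *\<^sub>R z)) * indicator {z. z /\<^sub>R u \<in> B} (u *\<^sub>R z) \<partial>lborel)"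
      by (rule nn_integral_lborel_scaleR[OF _ u]) measurable
    also have "\<dots> = ennreal (u ^ DIM('a)) * (\<integral>\<^sup>+z. ennreal (f (u *\<^sub>R z)) * indicator B z \<partial>lborel)"
      using u by (simp add: indicator_def)
    finally have "emeasure (scaled_law E s (\<lambda>_. M) (\<lambda>_. \<xi>) u) B =
       ennreal (u powr s * u powr DIM('a)) * (\<integral>\<^sup>+z. ennreal (f (u *\<^sub>R z)) * indicator B z \<partial>lborel)"
      using u by (subst emeasure_scaled_law[OF \<xi>m B]) (simp add: powr_realpow ennreal_mult mult.assoc)
    also have "\<dots> = (\<integral>\<^sup>+z. ennreal (u powr (s + DIM('a))) * (ennreal (f (u *\<^sub>R z)) * indicator B z) \<partial>lborel)"
      by (subst nn_integral_cmult) (simp_all add: powr_add)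
    finally show ?thesis using f by (simp add: ennreal_mult mult.assoc)
  qed
  show "((\<lambda>u. emeasure (scaled_law E s (\<lambda>_. M) (\<lambda>_. \<xi>) u) B) \<longlongrightarrow> emeasure \<nu> B) at_top"
    using scaled_density_tendsto[OF rv f fm B r(1) Br]
  proof (rule Lim_transform_eventually)
    show "\<forall>\<^sub>F u in at_top. (\<integral>\<^sup>+z. ennreal (u powr (s + DIM('a)) * f (u *\<^sub>R z)) * indicator B z \<partial>lborel)
      = emeasure (scaled_law E s (\<lambda>_. M) (\<lambda>_. \<xi>) u) B"
      using eventually_gt_at_top[of 0] by eventually_elim (rule eq)
  qed
qed

end

section \<open>Exceedance sets of asymptotically homogeneous losses\<close>

text \<open>The convergence clause of \<open>asymp_homogeneous_system\<close> for one loss,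
  separated from measurability and from positivity of the limit so that it can be studied one
  functional at a time.\<close>

definition asymp_homogeneous :: "'a::euclidean_space set \<Rightarrow> ('a \<Rightarrow> real) \<Rightarrow> ('a \<Rightarrow> real) \<Rightarrow> bool" where
  "asymp_homogeneous E L Lstar \<longleftrightarrow>
    (\<forall>z\<in>E. \<forall>\<zeta>. (\<forall>t. \<zeta> t \<in> E) \<and> (\<zeta> \<longlongrightarrow> z) at_top \<longrightarrow>
       ((\<lambda>t::real. L (t *\<^sub>R \<zeta> t) / t) \<longlongrightarrow> Lstar z) at_top)"

lemma asymp_homogeneousD:
  assumes "asymp_homogeneous E L Lstar" "z \<in> E" "\<And>t. \<zeta> t \<in> E" "(\<zeta> \<longlongrightarrow> z) at_top"
  shows "((\<lambda>t. L (t *\<^sub>R \<zeta> t) / t) \<longlongrightarrow> Lstar z) at_top"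
  using assms by (simp add: asymp_homogeneous_def)

lemma asymp_homogeneous_ray:
  assumes "asymp_homogeneous E L Lstar" "z \<in> E"
  shows "((\<lambda>t. L (t *\<^sub>R z) / t) \<longlongrightarrow> Lstar z) at_top"
  using assms by (intro asymp_homogeneousD[where \<zeta>="\<lambda>_. z"]) auto

text \<open>A violating sequence \<open>(t\<^sub>n, y\<^sub>n)\<close> with \<open>t\<^sub>n\<close> strictly increasing is the restriction of a single curve \<open>\<zeta>\<close>.\<close>

lemma asymp_homogeneous_local:
  fixes E :: "'a::euclidean_space set"
  assumes L: "asymp_homogeneous E L Lstar" and z: "z \<in> E" and e: "0 < e"
  obtains d T where "0 < d" "\<And>t y. T \<le> t \<Longrightarrow> y \<in> E \<Longrightarrow> dist y z < d \<Longrightarrow> \<bar>L (t *\<^sub>R y) / t - Lstar z\<bar> < e"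
proof (rule ccontr)
  assume no: "\<not> thesis"
  note thesisI = that
  have bad: "\<exists>t y. T \<le> t \<and> y \<in> E \<and> dist y z < d \<and> e \<le> \<bar>L (t *\<^sub>R y) / t - Lstar z\<bar>"
    if d: "0 < d" for d T
  proof (rule ccontr)
    assume "\<not> (\<exists>t y. T \<le> t \<and> y \<in> E \<and> dist y z < d \<and> e \<le> \<bar>L (t *\<^sub>R y) / t - Lstar z\<bar>)"
    then have "\<bar>L (t *\<^sub>R y) / t - Lstar z\<bar> < e" if "T \<le> t" "y \<in> E" "dist y z < d" for t y
      using that unfolding not_ex de_Morgan_conj not_le by (meson not_less)
    from thesisI[OF d this] no show False by blast
  qed
  \<comment> \<open>The bound \<open>real n \<le> fst p\<close> makes the times diverge; strict
    increase, imposed by the dependent choice below, makes them distinct, so that each time carries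
    only one point.\<close>
  define P where "P n p \<longleftrightarrow> real n \<le> fst p \<and> snd p \<in> E \<and> dist (snd p) z < 1 / Suc n
      \<and> e \<le> \<bar>L (fst p *\<^sub>R snd p) / fst p - Lstar z\<bar>" for n and p :: "real \<times> 'a"
  have "\<exists>p. \<forall>n. P n (p n) \<and> fst (p n) < fst (p (Suc n))"
  proof (rule dependent_nat_choice)
    show "\<exists>p. P 0 p" using bad[of 1 0] by (auto simp: P_def)
    fix p :: "real \<times> 'a" and n :: nat
    obtain t y where "max (Suc n) (fst p + 1) \<le> t" "y \<in> E" "dist y z < 1 / Suc (Suc n)"
      "e \<le> \<bar>L (t *\<^sub>R y) / t - Lstar z\<bar>"
      using bad[of "1 / Suc (Suc n)" "max (Suc n) (fst p + 1)"] by auto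
    then have "P (Suc n) (t, y) \<and> fst p < fst (t, y)" by (auto simp: P_def)
    then show "\<exists>q. P (Suc n) q \<and> fst p < fst q" ..
  qed
  then obtain p where P: "\<And>n. P n (p n)" and inc: "\<And>n. fst (p n) < fst (p (Suc n))" by blast
  define \<tau> where "\<tau> n = fst (p n)" for n
  define y where "y n = snd (p n)" for n
  have \<tau>: "real n \<le> \<tau> n" and yE: "y n \<in> E" and yz: "dist (y n) z < 1 / Suc n"
    and ye: "e \<le> \<bar>L (\<tau> n *\<^sub>R y n) / \<tau> n - Lstar z\<bar>" for n
    using P[of n] by (auto simp: P_def \<tau>_def y_def)
  have mono: "strict_mono \<tau>" using inc by (auto simp: strict_mono_Suc_iff \<tau>_def)
  \<comment> \<open>Away from the chosen times the curve rests at its limit z, which makes it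
    converge along all real t.\<close>
  define \<zeta> where "\<zeta> t = (if t \<in> range \<tau> then y (inv \<tau> t) else z)" for t
  have \<zeta>\<tau>: "\<zeta> (\<tau> n) = y n" for n
    using strict_mono_imp_inj_on[OF mono] by (simp add: \<zeta>_def)
  have "(\<zeta> \<longlongrightarrow> z) at_top"
  proof (rule tendstoI)
    fix \<epsilon> :: real assume "0 < \<epsilon>"
    then obtain m where m: "1 / Suc m < \<epsilon>"
      using reals_Archimedean[of \<epsilon>] by (auto simp: inverse_eq_divide)
    have "dist (\<zeta> t) z < \<epsilon>" if t: "\<tau> m \<le> t" for t
    proof (cases "t \<in> range \<tau>")
      case True
      then obtain n where n: "t = \<tau> n" by blast
      then have "m \<le> n" using t strict_mono_less_eq[OF mono] by simp
      then have "1 / Suc n \<le> 1 / Suc m" by (simp add: frac_le)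
      then show ?thesis using yz[of n] m by (simp add: n \<zeta>\<tau>)
    qed (use \<open>0 < \<epsilon>\<close> in \<open>simp add: \<zeta>_def\<close>)
    then show "\<forall>\<^sub>F t in at_top. dist (\<zeta> t) z < \<epsilon>" by (auto simp: eventually_at_top_linorder)
  qed
  moreover have "\<zeta> t \<in> E" for t using yE z by (simp add: \<zeta>_def)
  ultimately have "((\<lambda>t. L (t *\<^sub>R \<zeta> t) / t) \<longlongrightarrow> Lstar z) at_top"
    using L z by (intro asymp_homogeneousD)
  moreover have "filterlim \<tau> at_top sequentially"
    by (rule filterlim_at_top_mono[OF filterlim_real_sequentially]) (simp add: \<tau>)
  ultimately have "(\<lambda>n. L (\<tau> n *\<^sub>R \<zeta> (\<tau> n)) / \<tau> n) \<longlonglongrightarrow> Lstar z"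
    by (rule filterlim_compose)
  then have "\<forall>\<^sub>F n in sequentially. dist (L (\<tau> n *\<^sub>R \<zeta> (\<tau> n)) / \<tau> n) (Lstar z) < e"
    using e by (rule tendstoD)
  then obtain n where "dist (L (\<tau> n *\<^sub>R \<zeta> (\<tau> n)) / \<tau> n) (Lstar z) < e"
    by (auto simp: eventually_sequentially)
  then show False using ye[of n] by (simp add: \<zeta>\<tau> dist_real_def)
qed

text \<open>The local estimate holds for all y near z with the same threshold T. Keeping y fixed and
  letting t tend to infinity turns it into an estimate between \<open>Lstar y\<close> and
  \<open>Lstar z\<close>.\<close>

lemma asymp_homogeneous_limit_continuous:
  fixes E :: "'a::euclidean_space set"
  assumes L: "asymp_homogeneous E L Lstar"
  shows "continuous_on E Lstar"
  unfolding continuous_on_iff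
proof (intro ballI allI impI)
  fix z and e :: real assume z: "z \<in> E" and e: "0 < e"
  then have e2: "0 < e / 2" by simp
  obtain d T where d: "0 < d" and
    T: "\<And>t y. T \<le> t \<Longrightarrow> y \<in> E \<Longrightarrow> dist y z < d \<Longrightarrow> \<bar>L (t *\<^sub>R y) / t - Lstar z\<bar> < e / 2"
    using asymp_homogeneous_local[OF L z e2] by metis
  have "dist (Lstar y) (Lstar z) < e" if y: "y \<in> E" "dist y z < d" for y
  proof -
    have "((\<lambda>t. \<bar>L (t *\<^sub>R y) / t - Lstar z\<bar>) \<longlongrightarrow> \<bar>Lstar y - Lstar z\<bar>) at_top"
      by (intro tendsto_rabs tendsto_diff tendsto_const asymp_homogeneous_ray[OF L y(1)])
    moreover have "\<forall>\<^sub>F t in at_top. \<bar>L (t *\<^sub>R y) / t - Lstar z\<bar> \<le> e / 2"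
      using eventually_ge_at_top[of T] by eventually_elim (use T y in \<open>simp add: less_imp_le\<close>)
    ultimately have "\<bar>Lstar y - Lstar z\<bar> \<le> e / 2"
      by (rule tendsto_upperbound) simp
    then show ?thesis using e by (simp add: dist_real_def)
  qed
  then show "\<exists>d>0. \<forall>y\<in>E. dist y z < d \<longrightarrow> dist (Lstar y) (Lstar z) < e" using d by blast
qed

lemma asymp_homogeneous_limit_cone_functional:
  fixes E :: "'a::euclidean_space set"
  assumes E: "cone E" and L: "asymp_homogeneous E L Lstar"
  shows "cone_functional E Lstar"
  unfolding cone_functional_def
proof (intro conjI ballI allI impI)
  show "continuous_on E Lstar" by (rule asymp_homogeneous_limit_continuous[OF L])
  fix z c assume z: "z \<in> E" and c: "0 < (c::real)"
  have "((\<lambda>t. L ((t * c) *\<^sub>R z) / (t * c)) \<longlongrightarrow> Lstar z) at_top"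
    using c by (intro filterlim_compose[OF asymp_homogeneous_ray[OF L z]]
        filterlim_at_top_mult_tendsto_pos[OF tendsto_const _ filterlim_ident])
  then have "((\<lambda>t. c * (L ((t * c) *\<^sub>R z) / (t * c))) \<longlongrightarrow> c * Lstar z) at_top"
    by (rule tendsto_mult_left)
  then have "((\<lambda>t. L (t *\<^sub>R (c *\<^sub>R z)) / t) \<longlongrightarrow> c * Lstar z) at_top"
    using c by simp
  moreover have "((\<lambda>t. L (t *\<^sub>R (c *\<^sub>R z)) / t) \<longlongrightarrow> Lstar (c *\<^sub>R z)) at_top"
    using E z c by (intro asymp_homogeneous_ray[OF L] mem_cone) auto
  ultimately show "Lstar (c *\<^sub>R z) = c * Lstar z"
    by (intro tendsto_unique[OF trivial_limit_at_top_linorder])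
qed

text \<open>Near each z both \<open>L (t y) / t\<close> and \<open>Lstar y\<close> are within e/2 of
  \<open>Lstar z\<close>, the first for t beyond a threshold depending on z. A finite subcover of
  \<open>C\<close> leaves finitely many thresholds.\<close>

lemma asymp_homogeneous_uniform:
  fixes E :: "'a::euclidean_space set"
  assumes L: "asymp_homogeneous E L Lstar" and C: "compact C" "C \<subseteq> E" and e: "0 < e"
  shows "\<forall>\<^sub>F t in at_top. \<forall>y\<in>C. \<bar>L (t *\<^sub>R y) / t - Lstar y\<bar> < e"
proof -
  have "\<exists>G T. open G \<and> z \<in> G \<and> (\<forall>t\<ge>T. \<forall>y\<in>E \<inter> G. \<bar>L (t *\<^sub>R y) / t - Lstar y\<bar> < e)" if z: "z \<in> E" for z
  proof -
    have e2: "0 < e / 2" using e by simp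
    obtain d T where d: "0 < d" and
      T: "\<And>t y. T \<le> t \<Longrightarrow> y \<in> E \<Longrightarrow> dist y z < d \<Longrightarrow> \<bar>L (t *\<^sub>R y) / t - Lstar z\<bar> < e / 2"
      using asymp_homogeneous_local[OF L z e2] by metis
    obtain d' where d': "0 < d'" and
      c: "\<And>y. y \<in> E \<Longrightarrow> dist y z < d' \<Longrightarrow> dist (Lstar y) (Lstar z) < e / 2"
      using asymp_homogeneous_limit_continuous[OF L] z e2 unfolding continuous_on_iff by metis
    have "\<bar>L (t *\<^sub>R y) / t - Lstar y\<bar> < e" if "T \<le> t" "y \<in> E \<inter> ball z (min d d')" for t y
    proof -
      have "\<bar>L (t *\<^sub>R y) / t - Lstar z\<bar> < e / 2" "\<bar>Lstar y - Lstar z\<bar> < e / 2"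
        using T[of t y] c[of y] that by (simp_all add: dist_commute dist_real_def)
      then show ?thesis unfolding abs_less_iff by linarith
    qed
    then show ?thesis using d d' by (intro exI[of _ "ball z (min d d')"] exI[of _ T]) auto
  qed
  then obtain G T where G: "\<And>z. z \<in> E \<Longrightarrow> open (G z)" "\<And>z. z \<in> E \<Longrightarrow> z \<in> G z"
    and T: "\<And>z t y. z \<in> E \<Longrightarrow> T z \<le> t \<Longrightarrow> y \<in> E \<Longrightarrow> y \<in> G z \<Longrightarrow> \<bar>L (t *\<^sub>R y) / t - Lstar y\<bar> < e"
    by (metis IntI)
  have "C \<subseteq> (\<Union>z\<in>C. G z)" using G(2) C(2) by blast
  then obtain D where D: "D \<subseteq> C" "finite D" "C \<subseteq> (\<Union>z\<in>D. G z)"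
    using compactE_image[of C C G] C G(1) by (metis subsetD)
  have "\<forall>\<^sub>F t in at_top. \<forall>z\<in>D. T z \<le> t"
    using D(2) by (intro eventually_ball_finite) (auto simp: eventually_ge_at_top)
  then show ?thesis
  proof eventually_elim
    case (elim t)
    then show ?case using D C T by blast
  qed
qed

text \<open>The error \<open>\<epsilon> \<parallel>z\<parallel>\<close> is itself homogeneous, so both bounds on \<open>L (u z) / u\<close> are again cone functionals.\<close>

lemma asymp_homogeneous_sandwich:
  fixes E :: "'a::euclidean_space set"
  assumes E: "closed E" "cone E" and L: "asymp_homogeneous E L Lstar" and e: "0 < e" and r: "0 < r"
  shows "\<forall>\<^sub>F u in at_top. \<forall>z\<in>E. r \<le> norm z \<longrightarrow> \<bar>L (u *\<^sub>R z) / u - Lstar z\<bar> \<le> e * norm z"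
proof -
  have "compact (sphere_part E)" "sphere_part E \<subseteq> E"
    using E compact_sphere_part by (auto simp: sphere_part_def)
  then have "\<forall>\<^sub>F t in at_top. \<forall>w\<in>sphere_part E. \<bar>L (t *\<^sub>R w) / t - Lstar w\<bar> < e"
    using L e by (intro asymp_homogeneous_uniform)
  then obtain T where T: "\<And>t w. T \<le> t \<Longrightarrow> w \<in> sphere_part E \<Longrightarrow> \<bar>L (t *\<^sub>R w) / t - Lstar w\<bar> < e"
    by (auto simp: eventually_at_top_linorder)
  show ?thesis
    \<comment> \<open>Beyond T/r the time u norm z exceeds T for every z with norm at least r, so
      the uniform estimate on the sphere applies to \<open>sgn z\<close> at that time; multiplying
      it by norm z gives the claim.\<close>
    using eventually_gt_at_top[of "max 0 (T / r)"]
  proof eventually_elim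
    case (elim u)
    show ?case
    proof (intro ballI impI)
      fix z assume z: "z \<in> E" "r \<le> norm z"
      have nz: "0 < norm z" using z r by linarith
      have u: "0 < u" using elim by simp
      have "T < u * r" using elim r by (simp add: field_simps)
      also have "\<dots> \<le> u * norm z" using z u by simp
      finally have T': "T \<le> u * norm z" by simp
      have w: "sgn z \<in> sphere_part E"
        using z nz by (auto simp: sphere_part_def norm_sgn cone_sgn_iff[OF E(2)])
      have wE: "sgn z \<in> E" using w by (simp add: sphere_part_def)
      have zw: "norm z *\<^sub>R sgn z = z" using nz by (simp add: sgn_div_norm)
      have hom: "Lstar z = norm z * Lstar (sgn z)"
        using cone_functional_scaleR[OF asymp_homogeneous_limit_cone_functional[OF E(2) L] wE nz] zw by simp
      have "(u * norm z) *\<^sub>R sgn z = u *\<^sub>R z" using zw by (metis scaleR_scaleR)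
      then have "\<bar>L (u *\<^sub>R z) / (u * norm z) - Lstar (sgn z)\<bar> < e"
        using T[OF T' w] by simp
      then have "norm z * \<bar>L (u *\<^sub>R z) / (u * norm z) - Lstar (sgn z)\<bar> \<le> norm z * e"
        using nz by (intro mult_left_mono) auto
      moreover have "norm z * \<bar>L (u *\<^sub>R z) / (u * norm z) - Lstar (sgn z)\<bar>
          = \<bar>norm z * (L (u *\<^sub>R z) / (u * norm z) - Lstar (sgn z))\<bar>"
        by (simp add: abs_mult)
      moreover have "norm z * (L (u *\<^sub>R z) / (u * norm z) - Lstar (sgn z)) = L (u *\<^sub>R z) / u - Lstar z"
        using nz u unfolding hom by (simp add: field_simps)
      ultimately show "\<bar>L (u *\<^sub>R z) / u - Lstar z\<bar> \<le> e * norm z" by (simp add: mult.commute)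
    qed
  qed
qed

text \<open>The sandwich estimate gives no information near the origin. There the local estimate at
  z = 0 is used: \<open>Lstar 0 = 0\<close> keeps the rescaled loss below 1, so rescaled exceedance
  sets eventually avoid a fixed ball.\<close>

lemma asymp_homogeneous_near_0:
  fixes E :: "'a::euclidean_space set"
  assumes E: "cone E" "0 \<in> E" and L: "asymp_homogeneous E L Lstar"
  obtains r where "0 < r" "\<forall>\<^sub>F u in at_top. \<forall>z\<in>E. norm z < r \<longrightarrow> L (u *\<^sub>R z) / u < 1"
proof -
  have "Lstar 0 = 0"
    by (rule cone_functional_0[OF asymp_homogeneous_limit_cone_functional[OF E(1) L] E(2)])
  obtain d T where d: "0 < d" and
    T: "\<And>t y. T \<le> t \<Longrightarrow> y \<in> E \<Longrightarrow> dist y 0 < d \<Longrightarrow> \<bar>L (t *\<^sub>R y) / t - Lstar 0\<bar> < 1"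
    using asymp_homogeneous_local[OF L E(2) zero_less_one] by metis
  have "L (t *\<^sub>R z) / t < 1" if "T \<le> t" "z \<in> E" "norm z < d" for t z
  proof -
    have "\<bar>L (t *\<^sub>R z) / t\<bar> < 1" using T[of t z] that \<open>Lstar 0 = 0\<close> by simp
    then show ?thesis unfolding abs_less_iff by simp
  qed
  then have "\<forall>\<^sub>F u in at_top. \<forall>z\<in>E. norm z < d \<longrightarrow> L (u *\<^sub>R z) / u < 1"
    unfolding eventually_at_top_linorder by blast
  then show thesis using that d by blast
qed

section \<open>Limits of scaled joint exceedance probabilities\<close>

context homogeneous_tail
begin

text \<open>The limit depends on the family only through \<nu>. The moving rescaled sets are
  squeezed between fixed continuity sets with tolerance e, and as e shrinks the masses of these sets
  approach the mass of the limiting exceedance set from both sides.\<close>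

lemma joint_exceedance_tail_limit:
  assumes conv: "tail_preserving E s \<phi> N X"
    and X: "\<And>u. 0 < u \<Longrightarrow> X u \<in> borel_measurable (N u)"
    and N: "\<And>u. 0 < u \<Longrightarrow> prob_space (N u)"
    and J: "finite J" "J \<noteq> {}"
    and L: "\<And>j. j \<in> J \<Longrightarrow> asymp_homogeneous E (L j) (Lstar j)"
    and Lm: "\<And>j. j \<in> J \<Longrightarrow> L j \<in> borel_measurable (restrict_space borel E)"
  shows "((\<lambda>u. u powr s * \<P>(\<omega> in N u. X u \<omega> \<in> joint_exceedance E L u J))
    \<longlongrightarrow> measure \<nu> (joint_exceedance E Lstar 1 J)) at_top"
proof -
  let ?T = "joint_exceedance E Lstar 1 J" and ?\<mu> = "scaled_law E s N X"
  have Lst: "cone_functional E (Lstar j)" if "j \<in> J" for j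
    using asymp_homogeneous_limit_cone_functional[OF cone_E L[OF that]] .
  define G where "G e j z = Lstar j z + e * norm z" for e :: real and j and z :: 'a
  have G: "cone_functional E (G e j)" if "j \<in> J" for e j
    using Lst[OF that] unfolding cone_functional_def G_def
    by (auto intro!: continuous_intros simp: algebra_simps)
  \<comment> \<open>For u > 0 this is the exceedance set at level u divided by u.\<close>
  define A where "A u = {z \<in> E. \<forall>j\<in>J. 1 \<le> L j (u *\<^sub>R z) / u}" for u
  have near: "\<exists>r>0. \<forall>\<^sub>F u in at_top. \<forall>z\<in>A u. r \<le> norm z"
  proof -
    obtain j where j: "j \<in> J" using J by blast
    obtain r where "0 < r" "\<forall>\<^sub>F u in at_top. \<forall>z\<in>E. norm z < r \<longrightarrow> L j (u *\<^sub>R z) / u < 1"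
      using asymp_homogeneous_near_0[OF cone_E zero_in_E L[OF j]] by blast
    then show ?thesis
      using j by (intro exI[of _ r]) (force elim!: eventually_mono simp: A_def not_less[symmetric])
  qed
  then obtain r where r: "0 < r" "\<forall>\<^sub>F u in at_top. \<forall>z\<in>A u. r \<le> norm z" by blast
  have sandwich: "\<forall>\<^sub>F u in at_top. joint_exceedance E (G (- e)) 1 J \<subseteq> A u \<and> A u \<subseteq> joint_exceedance E (G e) 1 J"
    if e: "0 < e" for e
  proof -
    \<comment> \<open>The inner set must also keep a positive distance from the origin before the
      sandwich estimate can be applied on it; \<open>min r r'\<close> serves both
      inclusions.\<close>
    obtain r' where r': "0 < r'" "joint_exceedance E (G (- e)) 1 J \<subseteq> {z \<in> E - {0}. r' \<le> norm z}"
      using joint_exceedance_far[of J "G (- e)" 1] G J by auto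
    have "\<forall>\<^sub>F u in at_top. \<forall>j\<in>J. \<forall>z\<in>E. min r r' \<le> norm z \<longrightarrow> \<bar>L j (u *\<^sub>R z) / u - Lstar j z\<bar> \<le> e * norm z"
      using J(1) L e r(1) r'(1)
      by (intro eventually_ball_finite ballI asymp_homogeneous_sandwich closed_E cone_E) auto
    then show ?thesis using r(2)
    proof eventually_elim
      case (elim u)
      have "z \<in> A u" if z: "z \<in> joint_exceedance E (G (- e)) 1 J" for z
      proof -
        have "z \<in> E" "min r r' \<le> norm z" using z r' by auto
        then have "\<bar>L j (u *\<^sub>R z) / u - Lstar j z\<bar> \<le> e * norm z" if "j \<in> J" for j using elim(1) that by blast
        moreover have "1 \<le> Lstar j z - e * norm z" if "j \<in> J" for j
          using z that by (auto simp: joint_exceedance_def G_def)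
        ultimately show ?thesis using \<open>z \<in> E\<close> unfolding A_def by (fastforce simp: abs_le_iff)
      qed
      moreover have "z \<in> joint_exceedance E (G e) 1 J" if z: "z \<in> A u" for z
      proof -
        have "z \<in> E" "min r r' \<le> norm z" using z elim(2) by (auto simp: A_def)
        then have "\<bar>L j (u *\<^sub>R z) / u - Lstar j z\<bar> \<le> e * norm z" if "j \<in> J" for j using elim(1) that by blast
        moreover have "1 \<le> L j (u *\<^sub>R z) / u" if "j \<in> J" for j
          using z that by (auto simp: A_def)
        ultimately show ?thesis using \<open>z \<in> E\<close> unfolding joint_exceedance_def G_def
          by (fastforce simp: abs_le_iff)
      qed
      ultimately show ?case by blast
    qed
  qed
  \<comment> \<open>Only eventual membership is available: for small u the set \<open>A u\<close>
    may contain the origin and so fall outside the punctured cone.\<close>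
  have A_sets: "\<forall>\<^sub>F u in at_top. A u \<in> sets punctured"
    using r(2) eventually_gt_at_top[of 0]
  proof eventually_elim
    case (elim u)
    have scale: "(\<lambda>z. u *\<^sub>R z) \<in> restrict_space borel E \<rightarrow>\<^sub>M restrict_space borel E"
      using elim(2) mem_cone[OF cone_E]
      by (intro measurable_restrict_space2 measurable_restrict_space1) (auto simp: space_restrict_space)
    have m: "(\<lambda>z. L j (u *\<^sub>R z) / u) \<in> borel_measurable (restrict_space borel E)" if "j \<in> J" for j
      by (rule borel_measurable_divide[OF measurable_compose[OF scale Lm[OF that]] borel_measurable_const])
    have "{z \<in> space (restrict_space borel E). \<forall>j\<in>J. 1 \<le> L j (u *\<^sub>R z) / u} \<in> sets (restrict_space borel E)"
      by (rule sets.sets_Collect_finite_All[OF _ J(1)]) (rule borel_measurable_le[OF borel_measurable_const m])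
    then have "A u \<in> sets borel"
      unfolding A_def using E_borel(1) by (auto simp: space_restrict_space sets_restrict_space_iff)
    then show ?case using elim(1) r(1) unfolding sets_punctured by (force simp: A_def)
  qed
  have lev: "((\<lambda>u. emeasure (?\<mu> u) (joint_exceedance E (G e) 1 J)) \<longlongrightarrow> emeasure \<nu> (joint_exceedance E (G e) 1 J)) at_top" for e
  proof -
    have "joint_exceedance E (G e) 1 J \<in> sets punctured"
      "emeasure \<nu> (top_of_set (E - {0}) frontier_of joint_exceedance E (G e) 1 J) = 0"
      "0 \<notin> closure (joint_exceedance E (G e) 1 J)"
      using joint_exceedance_sets[of J "G e" 1] emeasure_frontier_joint_exceedance[of J "G e"]
        joint_exceedance_closed[of J "G e" 1] zero_notin_joint_exceedance[of J "G e" 1] G J by auto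
    then show ?thesis using conv unfolding tail_preserving_def M0_tendsto_def by blast
  qed
  have sub: "emeasure (?\<mu> u) B \<le> emeasure (?\<mu> u) B'"
    if "B \<subseteq> B'" "B' \<in> sets punctured" for B B' u
    using that by (intro emeasure_mono) (auto simp: scaled_law_def sets_restrict_space)
  have T_fin: "emeasure \<nu> ?T < \<infinity>" and T_set: "?T \<in> sets punctured"
    using emeasure_joint_exceedance_finite[of J Lstar 1] joint_exceedance_sets[of J Lstar 1] Lst J by auto
  have G_sets: "joint_exceedance E (G e) 1 J \<in> sets punctured" for e
    using joint_exceedance_sets[of J "G e" 1] G J by auto
  have lim: "((\<lambda>u. emeasure (?\<mu> u) (A u)) \<longlongrightarrow> emeasure \<nu> ?T) at_top"
  proof (rule order_tendstoI)
    fix l assume l: "l < emeasure \<nu> ?T"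
    let ?I = "\<lambda>n::nat. joint_exceedance E (G (- (1 / Suc n))) 1 J"
    have I_lim: "(\<lambda>n. emeasure \<nu> (?I n)) \<longlonglongrightarrow> emeasure \<nu> (\<Union>n. ?I n)"
    proof (rule Lim_emeasure_incseq)
      show "range ?I \<subseteq> sets \<nu>" using G_sets by (auto simp: sets_\<nu>)
      show "incseq ?I"
      proof (rule incseq_SucI, rule subsetI)
        fix n z assume z: "z \<in> ?I n"
        have "1 / real (Suc (Suc n)) * norm z \<le> 1 / real (Suc n) * norm z"
          by (intro mult_right_mono frac_le) auto
        then show "z \<in> ?I (Suc n)" using z unfolding joint_exceedance_def G_def by fastforce
      qed
    qed
    \<comment> \<open>The union of the inner sets misses points where some \<open>Lstar j z\<close>
      equals 1. It does contain the strict exceedance set, which has the same mass as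
      \<open>?T\<close>.\<close>
    have T_le: "emeasure \<nu> ?T \<le> emeasure \<nu> (\<Union>n. ?I n)"
    proof -
      let ?U = "{z \<in> E - {0}. \<forall>j\<in>J. 1 < Lstar j z}"
      have "?U \<subseteq> (\<Union>n. ?I n)"
      proof
        fix z assume z: "z \<in> ?U"
        have "(\<lambda>n. Lstar j z - 1 / Suc n * norm z) \<longlonglongrightarrow> Lstar j z - 0 * norm z" for j
          by (intro tendsto_diff tendsto_mult tendsto_const LIMSEQ_Suc[OF lim_1_over_n])
        then have "\<forall>\<^sub>F n in sequentially. \<forall>j\<in>J. 1 < Lstar j z - 1 / Suc n * norm z"
          using z J(1) by (intro eventually_ball_finite ballI order_tendstoD(1)[where y="Lstar _ z"]) auto
        then obtain n where "\<forall>j\<in>J. 1 < Lstar j z - 1 / Suc n * norm z"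
          unfolding eventually_sequentially by blast
        then have "z \<in> ?I n" using z by (auto simp: joint_exceedance_def G_def less_imp_le)
        then show "z \<in> (\<Union>n. ?I n)" by blast
      qed
      then have "emeasure \<nu> ?U \<le> emeasure \<nu> (\<Union>n. ?I n)"
        using G_sets by (intro emeasure_mono sets.countable_UN) (auto simp: sets_\<nu>)
      then show ?thesis using emeasure_strict_exceedance(1)[of J Lstar] Lst J by simp
    qed
    have "\<forall>\<^sub>F n in sequentially. l < emeasure \<nu> (?I n)"
      by (rule order_tendstoD(1)[OF I_lim less_le_trans[OF l T_le]])
    then obtain n where n: "l < emeasure \<nu> (?I n)" unfolding eventually_sequentially by blast
    have "\<forall>\<^sub>F u in at_top. l < emeasure (?\<mu> u) (?I n)"
      by (rule order_tendstoD(1)[OF lev n])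
    moreover have "\<forall>\<^sub>F u in at_top. ?I n \<subseteq> A u"
      using sandwich[of "1 / Suc n"] by (auto elim: eventually_mono)
    ultimately show "\<forall>\<^sub>F u in at_top. l < emeasure (?\<mu> u) (A u)"
      using A_sets by eventually_elim (use sub in \<open>blast intro: less_le_trans\<close>)
  next
    fix h assume h: "emeasure \<nu> ?T < h"
    let ?O = "\<lambda>n::nat. joint_exceedance E (G (1 / Suc n)) 1 J"
    have O_lim: "(\<lambda>n. emeasure \<nu> (?O n)) \<longlonglongrightarrow> emeasure \<nu> (\<Inter>n. ?O n)"
    proof (rule Lim_emeasure_decseq)
      show "range ?O \<subseteq> sets \<nu>" using G_sets by (auto simp: sets_\<nu>)
      show "decseq ?O"
      proof (rule decseq_SucI, rule subsetI)
        fix n z assume z: "z \<in> ?O (Suc n)"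
        have "1 / real (Suc (Suc n)) * norm z \<le> 1 / real (Suc n) * norm z"
          by (intro mult_right_mono frac_le) auto
        then show "z \<in> ?O n" using z unfolding joint_exceedance_def G_def by fastforce
      qed
      show "emeasure \<nu> (?O n) \<noteq> \<infinity>" for n
        using emeasure_joint_exceedance_finite[of J "G (1 / Suc n)" 1] G J by auto
    qed
    \<comment> \<open>On the outer side weak inequalities survive the limit, so no detour through
      strict exceedances is needed.\<close>
    have "(\<Inter>n. ?O n) \<subseteq> ?T"
    proof
      fix z assume z: "z \<in> (\<Inter>n. ?O n)"
      have "1 \<le> Lstar j z" if j: "j \<in> J" for j
      proof (rule LIMSEQ_le_const)
        have "(\<lambda>n. Lstar j z + 1 / Suc n * norm z) \<longlonglongrightarrow> Lstar j z + 0 * norm z"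
          by (intro tendsto_add tendsto_mult tendsto_const LIMSEQ_Suc[OF lim_1_over_n])
        then show "(\<lambda>n. Lstar j z + 1 / Suc n * norm z) \<longlonglongrightarrow> Lstar j z" by simp
        show "\<exists>N. \<forall>n\<ge>N. 1 \<le> Lstar j z + 1 / Suc n * norm z"
          using z j by (auto simp: joint_exceedance_def G_def)
      qed
      then show "z \<in> ?T" using z by (auto simp: joint_exceedance_def)
    qed
    then have le_T: "emeasure \<nu> (\<Inter>n. ?O n) \<le> emeasure \<nu> ?T"
      using T_set by (intro emeasure_mono) (auto simp: sets_\<nu>)
    have "\<forall>\<^sub>F n in sequentially. emeasure \<nu> (?O n) < h"
      by (rule order_tendstoD(2)[OF O_lim le_less_trans[OF le_T h]])
    then obtain n where n: "emeasure \<nu> (?O n) < h" unfolding eventually_sequentially by blast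
    have "\<forall>\<^sub>F u in at_top. emeasure (?\<mu> u) (?O n) < h"
      by (rule order_tendstoD(2)[OF lev n])
    moreover have "\<forall>\<^sub>F u in at_top. A u \<subseteq> ?O n"
      using sandwich[of "1 / Suc n"] by (auto elim: eventually_mono)
    ultimately show "\<forall>\<^sub>F u in at_top. emeasure (?\<mu> u) (A u) < h"
      by eventually_elim (use sub G_sets in \<open>blast intro: le_less_trans\<close>)
  qed
  have "((\<lambda>u. ennreal (u powr s * \<P>(\<omega> in N u. X u \<omega> \<in> joint_exceedance E L u J)))
      \<longlongrightarrow> ennreal (measure \<nu> ?T)) at_top"
  proof (rule Lim_transform_eventually)
    show "((\<lambda>u. emeasure (?\<mu> u) (A u)) \<longlongrightarrow> ennreal (measure \<nu> ?T)) at_top"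
      using lim T_fin by (simp add: emeasure_eq_ennreal_measure less_top)
    show "\<forall>\<^sub>F u in at_top. emeasure (?\<mu> u) (A u)
        = ennreal (u powr s * \<P>(\<omega> in N u. X u \<omega> \<in> joint_exceedance E L u J))"
      using A_sets eventually_gt_at_top[of 0]
    proof eventually_elim
      case (elim u)
      interpret prob_space "N u" using N elim by simp
      have "X u \<omega> /\<^sub>R u \<in> A u \<longleftrightarrow> X u \<omega> \<in> joint_exceedance E L u J" for \<omega>
        using elim(2) cone_scaleR_iff[OF cone_E, of "inverse u" "X u \<omega>"]
        by (simp add: A_def joint_exceedance_def)
      then show ?case
        using elim by (simp add: emeasure_scaled_law[of X u N, OF X] emeasure_eq_measure ennreal_mult)
    qed
  qed
  then show ?thesis
    by (rule tendsto_ennrealD) (auto intro!: eventuallyI)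
qed

end

section \<open>Convergence on level sets of cone functionals\<close>

lemma cone_functional_min:
  "cone_functional E f \<Longrightarrow> cone_functional E g \<Longrightarrow> cone_functional E (\<lambda>z. min (f z) (g z))"
  unfolding cone_functional_def by (auto intro!: continuous_intros simp: min_mult_distrib_left)

lemma cone_functional_max:
  "cone_functional E f \<Longrightarrow> cone_functional E g \<Longrightarrow> cone_functional E (\<lambda>z. max (f z) (g z))"
  unfolding cone_functional_def by (auto intro!: continuous_intros simp: max_mult_distrib_left)

lemma cone_functional_norm: "cone_functional E (\<lambda>z. c * norm z)"
  unfolding cone_functional_def by (auto intro!: continuous_intros)

text \<open>The vector y - (norm y / \<rho>) z measures how far y is from the point of the same norm
  on the ray through z. Thus {p \<ge> 1} is a narrow set around that ray beginning at radius \<rho>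
  - \<delta>, and removing {q \<ge> 1} cuts it off at radius \<rho> + \<delta>; what remains is a
  small cap around z.\<close>

lemma cone_functional_neighbourhood:
  fixes z :: "'a::real_normed_vector"
  assumes "z \<noteq> 0" "open S" "z \<in> S"
  obtains p q G where "cone_functional UNIV p" "cone_functional UNIV q" "open G" "z \<in> G"
    "G \<subseteq> {y. 1 \<le> p y} - {y. 1 \<le> q y}" "{y. 1 \<le> p y} - {y. 1 \<le> q y} \<subseteq> S"
proof -
  obtain e where e: "0 < e" "ball z e \<subseteq> S" using assms(2,3) by (meson open_contains_ball)
  define \<rho> where "\<rho> = norm z"
  \<comment> \<open>The cap turns out to lie within distance 2 \<open>\<delta>\<close> of z, whence
    e/2; the bound \<open>\<rho> / 2\<close> keeps \<open>\<rho> - \<delta>\<close>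
    positive.\<close>
  define \<delta> where "\<delta> = min (e / 2) (\<rho> / 2)"
  have \<rho>: "0 < \<rho>" using assms(1) by (simp add: \<rho>_def)
  then have "0 < \<delta>" "\<delta> \<le> e / 2" "\<delta> \<le> \<rho> / 2" using e by (simp_all add: \<delta>_def)
  with \<rho> have \<delta>: "0 < \<delta>" "\<delta> < \<rho>" "2 * \<delta> \<le> e" by linarith+
  \<comment> \<open>Chosen so that k \<delta> = (\<rho> + \<delta>) / (\<rho> - \<delta>), an upper
    bound of the first term of \<open>p\<close> inside the cap; then \<open>1 \<le> p y\<close>
    forces the deviation from the ray below \<delta>.\<close>
  define k where "k = (\<rho> + \<delta>) / (\<delta> * (\<rho> - \<delta>))"
  define p where "p = (\<lambda>y. norm y / (\<rho> - \<delta>) - k * norm (y - (norm y / \<rho>) *\<^sub>R z))"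
  define q where "q = (\<lambda>y::'a. norm y / (\<rho> + \<delta>))"
  have k: "0 < k" using \<delta> \<rho> by (simp add: k_def)
  have cp: "continuous_on UNIV p" and cq: "continuous_on UNIV q"
    unfolding p_def q_def using \<rho> \<delta> by (auto intro!: continuous_intros)
  show thesis
  proof
    show "cone_functional UNIV p"
      unfolding cone_functional_def
    proof (intro conjI ballI allI impI cp)
      fix y c assume c: "0 < (c::real)"
      have "c *\<^sub>R y - (norm (c *\<^sub>R y) / \<rho>) *\<^sub>R z = c *\<^sub>R (y - (norm y / \<rho>) *\<^sub>R z)"
        using c by (simp add: algebra_simps)
      then have "norm (c *\<^sub>R y - (norm (c *\<^sub>R y) / \<rho>) *\<^sub>R z) = c * norm (y - (norm y / \<rho>) *\<^sub>R z)"
        using c by simp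
      then show "p (c *\<^sub>R y) = c * p y"
        using c by (simp add: p_def algebra_simps)
    qed
    show "cone_functional UNIV q" using cq by (auto simp: cone_functional_def q_def)
    show "open ({y. 1 < p y} \<inter> {y. q y < 1})"
      by (intro open_Int open_Collect_less cp cq continuous_intros)
    have "p z = \<rho> / (\<rho> - \<delta>)" "q z = \<rho> / (\<rho> + \<delta>)"
      using \<rho> by (simp_all add: p_def q_def \<rho>_def)
    then show "z \<in> {y. 1 < p y} \<inter> {y. q y < 1}" using \<rho> \<delta> by simp
    show "{y. 1 < p y} \<inter> {y. q y < 1} \<subseteq> {y. 1 \<le> p y} - {y. 1 \<le> q y}" by auto
    show "{y. 1 \<le> p y} - {y. 1 \<le> q y} \<subseteq> S"
    proof
      fix y assume "y \<in> {y. 1 \<le> p y} - {y. 1 \<le> q y}"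
      then have p: "1 \<le> p y" and q: "q y < 1" by auto
      define D where "D = norm (y - (norm y / \<rho>) *\<^sub>R z)"
      have y1: "norm y < \<rho> + \<delta>" using q \<rho> \<delta> by (simp add: q_def)
      have kD: "1 + k * D \<le> norm y / (\<rho> - \<delta>)" using p by (simp add: p_def D_def)
      have "0 \<le> k * D" using k by (simp add: D_def)
      with kD have "1 \<le> norm y / (\<rho> - \<delta>)" by linarith
      then have y2: "\<rho> - \<delta> \<le> norm y" using \<delta> by (simp add: field_simps)
      have "k * D < norm y / (\<rho> - \<delta>)" using kD by linarith
      also have "\<dots> \<le> (\<rho> + \<delta>) / (\<rho> - \<delta>)" using y1 \<delta> by (simp add: divide_right_mono)
      also have "\<dots> = k * \<delta>" using \<delta> by (simp add: k_def)
      finally have "D < \<delta>" using k by simp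
      have "norm ((norm y / \<rho>) *\<^sub>R z - z) = \<bar>norm y / \<rho> - 1\<bar> * \<rho>"
        by (simp add: \<rho>_def scaleR_left_diff_distrib[of _ 1, simplified, symmetric])
      also have "\<dots> = \<bar>norm y - \<rho>\<bar>" using \<rho> by (simp add: abs_mult_pos[symmetric] field_simps)
      also have "\<dots> \<le> \<delta>" using y1 y2 by auto
      finally have "norm (y - z) < 2 * \<delta>"
        using norm_triangle_ineq[of "y - (norm y / \<rho>) *\<^sub>R z" "(norm y / \<rho>) *\<^sub>R z - z"] \<open>D < \<delta>\<close>
        by (simp add: D_def)
      then have "y \<in> ball z e" using \<delta> by (simp add: dist_norm norm_minus_commute)
      then show "y \<in> S" using e by auto
    qed
  qed
qed

definition level_set :: "'a set \<Rightarrow> ('a \<Rightarrow> real) \<Rightarrow> 'a set" where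
  "level_set E g = {z \<in> E. 1 \<le> g z}"

text \<open>Minima of cone functionals are again cone functionals, so intersections of test sets are
  test sets of one functional. This is why the converse can work with K = 1.\<close>

lemma level_set_min: "level_set E (\<lambda>z. min (f z) (g z)) = level_set E f \<inter> level_set E g"
  by (auto simp: level_set_def)

lemma level_set_far:
  fixes g :: "'a::real_normed_vector \<Rightarrow> real"
  assumes "cone_functional UNIV g"
  obtains r where "0 < r" "level_set E g \<subseteq> {z \<in> E - {0}. r < norm z}"
proof -
  have "open {z. g z < 1}"
    using assms by (intro open_Collect_less continuous_intros) (auto simp: cone_functional_def)
  moreover have "0 \<in> {z. g z < 1}" using cone_functional_0[OF assms] by simp
  ultimately obtain r where r: "0 < r" "cball 0 r \<subseteq> {z. g z < 1}"
    by (meson open_contains_cball)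
  then have "level_set E g \<subseteq> {z \<in> E - {0}. r < norm z}"
    using cone_functional_0[OF assms] by (force simp: level_set_def subset_iff not_le[symmetric])
  with r that show thesis by blast
qed

lemma level_set_borel:
  fixes g :: "'a::euclidean_space \<Rightarrow> real"
  assumes "closed E" "cone_functional UNIV g"
  shows "level_set E g \<in> sets borel"
proof -
  have [measurable]: "E \<in> sets borel" "g \<in> borel_measurable borel"
    using assms by (auto simp: cone_functional_def intro: borel_measurable_continuous_onI)
  show ?thesis unfolding level_set_def by measurable
qed

section \<open>Portmanteau argument from level sets to convergence in M0\<close>

lemma fmeasurable_M0:
  fixes m :: "'a::euclidean_space measure"
  assumes E: "closed E" and m: "m \<in> M0 E" and g: "cone_functional UNIV g"
    and B: "B \<in> sets borel" "B \<subseteq> level_set E g"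
  shows "B \<in> fmeasurable m"
proof (rule fmeasurableI)
  obtain r where r: "0 < r" "level_set E g \<subseteq> {z \<in> E - {0}. r < norm z}"
    using level_set_far[OF g] by blast
  have E': "E - {0} \<in> sets borel" "{z \<in> E - {0}. r < norm z} \<in> sets borel"
    using E by auto
  have sets: "A \<in> sets m \<longleftrightarrow> A \<in> sets borel \<and> A \<subseteq> E - {0}" for A
    using m E'(1) by (auto simp: M0_def sets_restrict_space_iff)
  show "B \<in> sets m" using sets B r by auto
  have "emeasure m B \<le> emeasure m {z \<in> E - {0}. r < norm z}"
    using sets B r E' by (intro emeasure_mono) auto
  also have "\<dots> < \<infinity>" using m r by (auto simp: M0_def)
  finally show "emeasure m B < \<infinity>" .
qed

lemma measure_M0_mono:
  fixes m :: "'a::euclidean_space measure"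
  assumes E: "closed E" and m: "m \<in> M0 E" and g: "cone_functional UNIV g"
    and "A \<in> sets borel" "B \<in> sets borel" "A \<subseteq> B" "B \<subseteq> level_set E g"
  shows "measure m A \<le> measure m B"
  using assms by (intro measure_mono_fmeasurable fmeasurableD[OF fmeasurable_M0[OF E m g]] fmeasurable_M0[OF E m g]) auto

lemma measure_M0_Diff:
  fixes m :: "'a::euclidean_space measure"
  assumes E: "closed E" and m: "m \<in> M0 E" and g: "cone_functional UNIV g"
    and "A \<in> sets borel" "B \<in> sets borel" "A \<subseteq> B" "B \<subseteq> level_set E g"
  shows "measure m (B - A) = measure m B - measure m A"
  using assms by (intro measurable_measure_Diff fmeasurableD[OF fmeasurable_M0[OF E m g]] fmeasurable_M0[OF E m g]) auto

text \<open>Level sets are only a \<open>\<inter>\<close>-stable class; inclusion--exclusion passes to finite unions of differences.\<close>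

lemma measure_level_set_union_step:
  fixes m :: "'a::euclidean_space measure"
  assumes E: "closed E" and m: "m \<in> M0 E"
    and U: "U \<in> sets borel"
    and cf: "cone_functional UNIV p" "cone_functional UNIV q" "cone_functional UNIV g"
  defines "P \<equiv> (\<lambda>z. min (g z) (p z))" and "Q \<equiv> (\<lambda>z. min (min (g z) (p z)) (q z))"
  shows "measure m ((U \<union> (level_set E p - level_set E q)) \<inter> level_set E g) =
    measure m (U \<inter> level_set E g) + (measure m (level_set E P) - measure m (level_set E Q))
      - (measure m (U \<inter> level_set E P) - measure m (U \<inter> level_set E Q))"
proof -
  let ?g = "level_set E g" and ?P = "level_set E P" and ?Q = "level_set E Q"
  have PQ: "?P = ?g \<inter> level_set E p" "?Q = ?P \<inter> level_set E q"
    by (simp_all add: P_def Q_def level_set_min Int_assoc)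
  note [measurable] = U level_set_borel[OF E cf(1)] level_set_borel[OF E cf(2)] level_set_borel[OF E cf(3)]
  have fm: "B \<in> fmeasurable m" if "B \<in> sets borel" "B \<subseteq> ?g" for B
    using fmeasurable_M0[OF E m cf(3) that] .
  have "(U \<union> (level_set E p - level_set E q)) \<inter> ?g = (U \<inter> ?g) \<union> (?P - ?Q)"
    using PQ by auto
  moreover have "measure m ((U \<inter> ?g) \<union> (?P - ?Q)) =
     measure m (U \<inter> ?g) + measure m (?P - ?Q) - measure m ((U \<inter> ?g) \<inter> (?P - ?Q))"
    using PQ by (intro measure_Un3 fm) auto
  moreover have "(U \<inter> ?g) \<inter> (?P - ?Q) = (U \<inter> ?P) - (U \<inter> ?Q)" using PQ by auto
  moreover have "measure m (?P - ?Q) = measure m ?P - measure m ?Q"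
    using PQ by (intro measure_M0_Diff[OF E m cf(3)]) auto
  moreover have "measure m ((U \<inter> ?P) - (U \<inter> ?Q)) = measure m (U \<inter> ?P) - measure m (U \<inter> ?Q)"
    using PQ by (intro measure_M0_Diff[OF E m cf(3)]) auto
  ultimately show ?thesis by simp
qed

text \<open>Lower bounds on open sets come from exhausting them by finite unions of differences of
  level sets. Inside a level set containing the given set, convergence of the total mass turns these
  into upper bounds on closed sets, and the null frontier closes the gap.\<close>

lemma M0_tendstoI_level_sets:
  fixes \<mu> :: "'i \<Rightarrow> 'a::euclidean_space measure"
  assumes E: "closed E" and \<mu>: "\<forall>\<^sub>F i in F. \<mu> i \<in> M0 E" and \<nu>: "\<nu> \<in> M0 E"
    and conv: "\<And>g. cone_functional UNIV g \<Longrightarrow>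
      ((\<lambda>i. measure (\<mu> i) (level_set E g)) \<longlongrightarrow> measure \<nu> (level_set E g)) F"
  shows "M0_tendsto E \<mu> \<nu> F"
proof -
  have union: "((\<lambda>i. measure (\<mu> i) ((\<Union>k<n. level_set E (p k) - level_set E (q k)) \<inter> level_set E g))
      \<longlongrightarrow> measure \<nu> ((\<Union>k<n. level_set E (p k) - level_set E (q k)) \<inter> level_set E g)) F"
    if pq: "\<And>k. cone_functional UNIV (p k)" "\<And>k. cone_functional UNIV (q k)" and g: "cone_functional UNIV g"
    for p q :: "nat \<Rightarrow> 'a \<Rightarrow> real" and n g
    using g
  \<comment> \<open>The functional stays general because the inclusion-exclusion step invokes the
    claim for \<open>g\<close> and for two minima built from \<open>g\<close>, \<open>p n\<close>
    and \<open>q n\<close>.\<close>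
  proof (induction n arbitrary: g)
    case 0
    then show ?case by simp
  next
    case (Suc n)
    let ?U = "\<Union>k<n. level_set E (p k) - level_set E (q k)"
    have U: "?U \<in> sets borel" using level_set_borel[OF E pq(1)] level_set_borel[OF E pq(2)] by auto
    have eq: "(\<Union>k<Suc n. level_set E (p k) - level_set E (q k)) = ?U \<union> (level_set E (p n) - level_set E (q n))"
      by (auto simp: lessThan_Suc)
    note step = measure_level_set_union_step[OF E _ U pq(1)[of n] pq(2)[of n] Suc.prems]
    have "((\<lambda>i. measure (\<mu> i) (?U \<inter> level_set E g)
          + (measure (\<mu> i) (level_set E (\<lambda>z. min (g z) (p n z)))
              - measure (\<mu> i) (level_set E (\<lambda>z. min (min (g z) (p n z)) (q n z))))
          - (measure (\<mu> i) (?U \<inter> level_set E (\<lambda>z. min (g z) (p n z)))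
              - measure (\<mu> i) (?U \<inter> level_set E (\<lambda>z. min (min (g z) (p n z)) (q n z)))))
        \<longlongrightarrow> measure \<nu> ((?U \<union> (level_set E (p n) - level_set E (q n))) \<inter> level_set E g)) F"
      unfolding step[OF \<nu>]
      by (intro tendsto_add tendsto_diff conv Suc.IH cone_functional_min Suc.prems pq)
    moreover have "\<forall>\<^sub>F i in F. measure (\<mu> i) (?U \<inter> level_set E g)
          + (measure (\<mu> i) (level_set E (\<lambda>z. min (g z) (p n z)))
              - measure (\<mu> i) (level_set E (\<lambda>z. min (min (g z) (p n z)) (q n z))))
          - (measure (\<mu> i) (?U \<inter> level_set E (\<lambda>z. min (g z) (p n z)))
              - measure (\<mu> i) (?U \<inter> level_set E (\<lambda>z. min (min (g z) (p n z)) (q n z))))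
        = measure (\<mu> i) ((?U \<union> (level_set E (p n) - level_set E (q n))) \<inter> level_set E g)"
      using \<mu> by eventually_elim (rule step[symmetric])
    ultimately show ?case unfolding eq by (rule Lim_transform_eventually)
  qed

  have lower: "\<forall>\<^sub>F i in F. l < measure (\<mu> i) (S \<inter> level_set E g)"
    if S: "open S" and g: "cone_functional UNIV g" and l: "l < measure \<nu> (S \<inter> level_set E g)" for S g l
  proof -
    define good where "good G p q \<longleftrightarrow> cone_functional UNIV p \<and> cone_functional UNIV q \<and> open G \<and>
        G \<subseteq> {y. 1 \<le> p y} - {y. 1 \<le> q y} \<and> {y. 1 \<le> p y} - {y. 1 \<le> q y} \<subseteq> S"
      for G and p q :: "'a \<Rightarrow> real"
    have good_empty: "good {} (\<lambda>_. 0 * norm (0::'a)) (\<lambda>_. 0 * norm (0::'a))"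
      by (auto simp: good_def cone_functional_def)
    \<comment> \<open>Lindelof leaves countably many of the admissible open pieces without shrinking
      their union, so finite unions of the corresponding differences exhaust S within the level
      set.\<close>
    obtain \<F> where \<F>: "\<F> \<subseteq> {G. \<exists>p q. good G p q}" "countable \<F>" "\<Union>\<F> = \<Union>{G. \<exists>p q. good G p q}"
      by (rule Lindelof[of "{G. \<exists>p q. good G p q}"]) (auto simp: good_def)
    \<comment> \<open>The empty set, which is admissible by \<open>good_empty\<close>, is inserted
      so that the enumerated family is nonempty.\<close>
    define G where "G = from_nat_into (insert {} \<F>)"
    have rG: "range G = insert {} \<F>"
      unfolding G_def using \<F>(2) by (intro range_from_nat_into) auto
    have "\<exists>p q. good (G k) p q" for k
    proof (cases "G k = {}")
      case True
      then show ?thesis using good_empty by metis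
    next
      case False
      then have "G k \<in> \<F>" using rangeI[of G k] rG by auto
      then show ?thesis using \<F>(1) by auto
    qed
    then obtain p q where pq: "\<And>k. good (G k) (p k) (q k)" by metis
    define U where "U n = (\<Union>k<n. level_set E (p k) - level_set E (q k))" for n
    have Ub: "U n \<in> sets borel" for n
      unfolding U_def using pq level_set_borel[OF E] by (auto simp: good_def)
    have US: "U n \<subseteq> S" for n
      unfolding U_def using pq by (fastforce simp: good_def level_set_def)
    have "S \<inter> level_set E g \<subseteq> (\<Union>n. U n)"
    proof
      fix z assume z: "z \<in> S \<inter> level_set E g"
      then have "z \<noteq> 0" using cone_functional_0[OF g] by (auto simp: level_set_def)
      moreover have "z \<in> S" using z by simp
      ultimately obtain p' q' G' where "cone_functional UNIV p'" "cone_functional UNIV q'" "open G'"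
        and "z \<in> G'" and "G' \<subseteq> {y. 1 \<le> p' y} - {y. 1 \<le> q' y}" "{y. 1 \<le> p' y} - {y. 1 \<le> q' y} \<subseteq> S"
        by (rule cone_functional_neighbourhood[OF _ S])
      then have "good G' p' q'" by (simp add: good_def)
      with \<open>z \<in> G'\<close> have "z \<in> \<Union>\<F>" unfolding \<F>(3) by blast
      then have "z \<in> \<Union>(range G)" unfolding rG by simp
      then obtain k where "z \<in> G k" by blast
      then have "z \<in> level_set E (p k) - level_set E (q k)"
        using pq[of k] z by (auto simp: good_def level_set_def)
      then have "z \<in> U (Suc k)" unfolding U_def by blast
      then show "z \<in> (\<Union>n. U n)" by blast
    qed
    then have Seq: "(\<Union>n. U n \<inter> level_set E g) = S \<inter> level_set E g" using US by auto
    have Sb: "S \<inter> level_set E g \<in> sets borel" using S level_set_borel[OF E g] by auto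
    have "(\<lambda>n. measure \<nu> (U n \<inter> level_set E g)) \<longlonglongrightarrow> measure \<nu> (\<Union>n. U n \<inter> level_set E g)"
    proof (rule Lim_measure_incseq)
      show "range (\<lambda>n. U n \<inter> level_set E g) \<subseteq> sets \<nu>"
      proof (rule image_subsetI)
        fix n
        have "U n \<inter> level_set E g \<in> sets borel" using Ub level_set_borel[OF E g] by (rule sets.Int)
        then show "U n \<inter> level_set E g \<in> sets \<nu>"
          by (rule fmeasurableD[OF fmeasurable_M0[OF E \<nu> g]]) auto
      qed
      show "incseq (\<lambda>n. U n \<inter> level_set E g)"
        unfolding U_def by (intro incseq_SucI) (auto simp: lessThan_Suc)
      show "emeasure \<nu> (\<Union>n. U n \<inter> level_set E g) \<noteq> \<infinity>"
        unfolding Seq using fmeasurable_M0[OF E \<nu> g Sb] by (auto simp: fmeasurable_def)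
    qed
    then have "\<forall>\<^sub>F n in sequentially. l < measure \<nu> (U n \<inter> level_set E g)"
      using l unfolding Seq by (rule order_tendstoD(1))
    then obtain n where n: "l < measure \<nu> (U n \<inter> level_set E g)"
      by (auto simp: eventually_sequentially)
    have "\<forall>\<^sub>F i in F. l < measure (\<mu> i) (U n \<inter> level_set E g)"
      using order_tendstoD(1)[OF union[of p q g n, folded U_def] n] pq g by (simp add: good_def)
    then show ?thesis using \<mu>
    proof eventually_elim
      case (elim i)
      have "measure (\<mu> i) (U n \<inter> level_set E g) \<le> measure (\<mu> i) (S \<inter> level_set E g)"
        using US Ub level_set_borel[OF E g] Sb
        by (intro measure_M0_mono[OF E elim(2) g]) auto
      with elim show ?case by simp
    qed
  qed

  show ?thesis
    unfolding M0_tendsto_def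
  proof (intro conjI ballI impI \<mu> \<nu>)
    fix B assume B: "B \<in> sets (restrict_space borel (E - {0}))"
      and "emeasure \<nu> (top_of_set (E - {0}) frontier_of B) = 0 \<and> 0 \<notin> closure B"
    then have fr: "emeasure \<nu> (top_of_set (E - {0}) frontier_of B) = 0" and B0: "0 \<notin> closure B" by auto
    have "E - {0} \<in> sets borel" using E by auto
    then have Bb: "B \<in> sets borel" "B \<subseteq> E - {0}" using B by (auto simp: sets_restrict_space_iff)
    obtain r where r: "0 < r" "ball 0 r \<subseteq> - closure B"
      using B0 open_contains_ball[of "- closure B"] by auto
    \<comment> \<open>Its level set is the part of the cone with norm at least r. It contains
      \<open>B\<close>, has finite mass and is itself a test set, so complements can be taken inside
      it.\<close>
    define g where "g = (\<lambda>z::'a. (1 / r) * norm z)"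
    have g: "cone_functional UNIV g" unfolding g_def by (rule cone_functional_norm)
    let ?W = "level_set E g"
    have W: "?W = {z \<in> E. r \<le> norm z}" using r by (auto simp: level_set_def g_def field_simps)
    note Wb = level_set_borel[OF E g]
    have BW: "B \<subseteq> ?W"
    proof
      fix z assume "z \<in> B"
      then have "z \<notin> ball 0 r" using r closure_subset[of B] by auto
      with \<open>z \<in> B\<close> Bb show "z \<in> ?W" by (auto simp: W)
    qed
    let ?X = "top_of_set (E - {0})"
    \<comment> \<open>Interior and closure in the punctured cone are written as traces of ambient
      sets, because the bound \<open>lower\<close> speaks of ambient open sets.\<close>
    obtain I where I: "open I" "?X interior_of B = (E - {0}) \<inter> I"
      using openin_interior_of[of ?X B] unfolding openin_open by blast
    obtain C where C: "closed C" "?X closure_of B = (E - {0}) \<inter> C"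
      using closedin_closure_of[of ?X B] unfolding closedin_closed by blast
    have IB: "I \<inter> ?W \<subseteq> B"
      using interior_of_subset[of ?X B] I r by (auto simp: W)
    have BI: "(E - {0}) \<inter> I \<subseteq> I \<inter> ?W"
      using interior_of_subset[of ?X B] I BW by auto
    have BC: "B \<subseteq> C \<inter> ?W"
      using closure_of_subset[of B ?X] Bb C BW by auto
    have Cb: "C \<inter> ?W \<in> sets borel" "I \<inter> ?W \<in> sets borel" "- C \<inter> ?W \<in> sets borel"
      using C I Wb by (auto intro!: sets.Int borel_closed borel_open)
    have fm: "A \<in> fmeasurable m" if "m \<in> M0 E" "A \<in> sets borel" "A \<subseteq> ?W" for A m
      using fmeasurable_M0[OF E that(1) g that(2,3)] .
    have diff: "measure m (C \<inter> ?W) = measure m ?W - measure m (- C \<inter> ?W)" if "m \<in> M0 E" for m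
    proof -
      have "measure m (?W - (- C \<inter> ?W)) = measure m ?W - measure m (- C \<inter> ?W)"
        using Cb Wb by (intro measure_M0_Diff[OF E that g]) auto
      moreover have "?W - (- C \<inter> ?W) = C \<inter> ?W" by auto
      ultimately show ?thesis by simp
    qed
    have frontier: "measure \<nu> (C \<inter> ?W) = measure \<nu> B" "measure \<nu> (I \<inter> ?W) = measure \<nu> B"
    proof -
      have sets: "A \<in> sets \<nu> \<longleftrightarrow> A \<in> sets borel \<and> A \<subseteq> E - {0}" for A
        using \<nu> \<open>E - {0} \<in> sets borel\<close> by (auto simp: M0_def sets_restrict_space_iff)
      have "(C \<inter> ?W) - (I \<inter> ?W) \<subseteq> ?X frontier_of B"
        using C I r by (auto simp: frontier_of_def W)
      moreover have "?X frontier_of B \<in> sets \<nu>"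
      proof -
        have "?X frontier_of B = ((E - {0}) \<inter> C) - ((E - {0}) \<inter> I)"
          by (simp add: frontier_of_def C(2) I(2))
        also have "\<dots> \<in> sets borel"
          using C I \<open>E - {0} \<in> sets borel\<close> by (auto intro!: sets.Diff sets.Int borel_closed borel_open)
        finally show ?thesis using sets frontier_of_subset_topspace[of ?X B] by auto
      qed
      ultimately have "emeasure \<nu> ((C \<inter> ?W) - (I \<inter> ?W)) = 0"
        using fr emeasure_mono[of "(C \<inter> ?W) - (I \<inter> ?W)" "?X frontier_of B" \<nu>] by simp
      then have "measure \<nu> ((C \<inter> ?W) - (I \<inter> ?W)) = 0" by (simp add: measure_def)
      moreover have "measure \<nu> ((C \<inter> ?W) - (I \<inter> ?W)) = measure \<nu> (C \<inter> ?W) - measure \<nu> (I \<inter> ?W)"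
        using Cb IB BC by (intro measure_M0_Diff[OF E \<nu> g]) auto
      moreover have "measure \<nu> (I \<inter> ?W) \<le> measure \<nu> B"
        using Cb Bb IB BW by (intro measure_M0_mono[OF E \<nu> g]) auto
      moreover have "measure \<nu> B \<le> measure \<nu> (C \<inter> ?W)"
        using Cb Bb BC BW by (intro measure_M0_mono[OF E \<nu> g]) auto
      ultimately show "measure \<nu> (C \<inter> ?W) = measure \<nu> B" "measure \<nu> (I \<inter> ?W) = measure \<nu> B" by auto
    qed
    have "((\<lambda>i. measure (\<mu> i) B) \<longlongrightarrow> measure \<nu> B) F"
    proof (rule order_tendstoI)
      fix l assume "l < measure \<nu> B"
      then have "\<forall>\<^sub>F i in F. l < measure (\<mu> i) (I \<inter> ?W)"
        using lower[OF I(1) g] frontier by simp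
      then show "\<forall>\<^sub>F i in F. l < measure (\<mu> i) B" using \<mu>
      proof eventually_elim
        case (elim i)
        have "measure (\<mu> i) (I \<inter> ?W) \<le> measure (\<mu> i) B"
          using Cb Bb IB BW by (intro measure_M0_mono[OF E elim(2) g]) auto
        with elim show ?case by simp
      qed
    next
      fix h assume h: "measure \<nu> B < h"
      \<comment> \<open>The upper bound loses e twice: once for the mass of \<open>?W\<close> and
        once for the part of \<open>?W\<close> outside \<open>C\<close>.\<close>
      define e where "e = (h - measure \<nu> B) / 2"
      have e: "0 < e" using h by (simp add: e_def)
      have "\<forall>\<^sub>F i in F. measure \<nu> (- C \<inter> ?W) - e < measure (\<mu> i) (- C \<inter> ?W)"
        using C e by (intro lower[OF _ g]) auto
      moreover have "\<forall>\<^sub>F i in F. measure (\<mu> i) ?W < measure \<nu> ?W + e"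
        using conv[OF g] e by (intro order_tendstoD(2)) auto
      ultimately show "\<forall>\<^sub>F i in F. measure (\<mu> i) B < h" using \<mu>
      proof eventually_elim
        case (elim i)
        have "measure (\<mu> i) B \<le> measure (\<mu> i) (C \<inter> ?W)"
          using Cb Bb BC BW by (intro measure_M0_mono[OF E elim(3) g]) auto
        moreover have "h - measure \<nu> B = 2 * e" by (simp add: e_def)
        ultimately show ?case
          using elim(1,2) diff[OF elim(3)] diff[OF \<nu>] frontier(1) by linarith
      qed
    qed
    then have "((\<lambda>i. ennreal (measure (\<mu> i) B)) \<longlongrightarrow> ennreal (measure \<nu> B)) F" by (rule tendsto_ennrealI)
    moreover have "\<forall>\<^sub>F i in F. ennreal (measure (\<mu> i) B) = emeasure (\<mu> i) B"
      using \<mu> by eventually_elim (use fm[OF _ Bb(1) BW] in \<open>simp add: emeasure_eq_measure2\<close>)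
    moreover have "ennreal (measure \<nu> B) = emeasure \<nu> B"
      using fm[OF \<nu> Bb(1) BW] by (simp add: emeasure_eq_measure2)
    ultimately show "((\<lambda>i. emeasure (\<mu> i) B) \<longlongrightarrow> emeasure \<nu> B) F"
      by (auto intro: Lim_transform_eventually)
  qed
qed

section \<open>Tail preservation and exceedance probabilities\<close>

text \<open>A nonzero limit makes each scaled function equivalent to the same constant, and the
  factor u^s then cancels. The condition \<open>a \<noteq> 0\<close> is where regularity of the
  system enters.\<close>

lemma asymp_equiv_of_scaled_limits:
  fixes p q :: "real \<Rightarrow> real"
  assumes "((\<lambda>u. u powr s * p u) \<longlongrightarrow> a) at_top" "((\<lambda>u. u powr s * q u) \<longlongrightarrow> a) at_top" "a \<noteq> 0"
  shows "p \<sim>[at_top] q"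
proof -
  have "(\<lambda>u. u powr s * p u) \<sim>[at_top] (\<lambda>u. u powr s * q u)"
    using tendsto_imp_asymp_equiv_const[OF assms(1,3)] tendsto_imp_asymp_equiv_const[OF assms(2,3)]
    by (metis asymp_equiv_symI asymp_equiv_trans)
  then have "(\<lambda>u. u powr - s * (u powr s * p u)) \<sim>[at_top] (\<lambda>u. u powr - s * (u powr s * q u))"
    by (rule asymp_equiv_mult[OF asymp_equiv_refl])
  moreover have eq: "\<forall>\<^sub>F u in at_top. u powr - s * (u powr s * r u) = r u" for r :: "real \<Rightarrow> real"
    using eventually_gt_at_top[of 0] by eventually_elim (simp add: mult.assoc[symmetric] powr_add[symmetric])
  ultimately show ?thesis using asymp_equiv_cong[OF eq[of p] eq[of q]] by blast
qed

lemma scaled_limit_of_asymp_equiv: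
  fixes p q :: "real \<Rightarrow> real"
  assumes "p \<sim>[at_top] q" "((\<lambda>u. u powr s * q u) \<longlongrightarrow> a) at_top"
  shows "((\<lambda>u. u powr s * p u) \<longlongrightarrow> a) at_top"
proof (rule asymp_equiv_tendsto_transfer[OF _ assms(2)])
  show "(\<lambda>u. u powr s * q u) \<sim>[at_top] (\<lambda>u. u powr s * p u)"
    using assms(1) by (intro asymp_equiv_mult asymp_equiv_refl) (rule asymp_equiv_symI)
qed

lemma cone_functional_system:
  fixes E :: "'a::euclidean_space set"
  assumes g: "cone_functional UNIV g" and pos: "z0 \<in> E" "0 < g z0"
  shows "asymp_homogeneous_system E K (\<lambda>_. g) (\<lambda>_. g)"
  unfolding asymp_homogeneous_system_def
proof (intro ballI conjI allI impI)
  have cont: "continuous_on UNIV g" using g by (simp add: cone_functional_def)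
  then show "g \<in> borel_measurable (restrict_space borel E)"
    by (intro measurable_restrict_space1 borel_measurable_continuous_onI)
  show "\<exists>z\<in>E. 0 < g z" using pos by blast
  fix z and \<zeta> :: "real \<Rightarrow> 'a" assume "(\<forall>t. \<zeta> t \<in> E) \<and> (\<zeta> \<longlongrightarrow> z) at_top"
  then have "((\<lambda>t. g (\<zeta> t)) \<longlongrightarrow> g z) at_top"
    by (intro continuous_on_tendsto_compose[OF cont]) auto
  moreover have "\<forall>\<^sub>F t in at_top. g (\<zeta> t) = g (t *\<^sub>R \<zeta> t) / t"
    using eventually_gt_at_top[of 0]
    by eventually_elim (simp add: cone_functional_scaleR[OF g])
  ultimately show "((\<lambda>t. g (t *\<^sub>R \<zeta> t) / t) \<longlongrightarrow> g z) at_top"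
    by (rule Lim_transform_eventually)
qed

lemma asymp_homogeneous_of_system:
  assumes "asymp_homogeneous_system E K L Lstar" "j \<in> {1..K}"
  shows "asymp_homogeneous E (L j) (Lstar j)" "L j \<in> borel_measurable (restrict_space borel E)"
proof -
  note sys = bspec[OF assms(1)[unfolded asymp_homogeneous_system_def] assms(2)]
  show "L j \<in> borel_measurable (restrict_space borel E)" by (rule conjunct1[OF sys])
  show "asymp_homogeneous E (L j) (Lstar j)"
    unfolding asymp_homogeneous_def by (rule conjunct2[OF conjunct2[OF sys]])
qed

lemma level_set_eq_joint_exceedance: "level_set E g = joint_exceedance E (\<lambda>_. g) 1 {1}"
  by (auto simp: level_set_def joint_exceedance_def)

section \<open>Recognising tail preservation through admissible homogeneous losses\<close>

context homogeneous_tail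
begin

text \<open>If one such set were null, scaling would make the sets with radius r/(n+1) null as well,
  and these exhaust \<open>E - {0}\<close>.\<close>

lemma emeasure_\<nu>_far_pos:
  assumes E: "emeasure lborel (E - {0}) \<noteq> 0" and r: "0 < r"
  shows "emeasure \<nu> {z \<in> E - {0}. r \<le> norm z} \<noteq> 0"
proof
  assume 0: "emeasure \<nu> {z \<in> E - {0}. r \<le> norm z} = 0"
  have "emeasure \<nu> {z \<in> E - {0}. r / Suc n \<le> norm z} = 0" for n
  proof -
    have "emeasure \<nu> {z \<in> E - {0}. r / Suc n \<le> norm z}
      = ennreal ((1 / Suc n) powr - s) * emeasure \<nu> {z \<in> E - {0}. r \<le> norm z}"
      using cone_scaleR_iff[OF cone_E, of "1 / Suc n"]
      by (intro emeasure_\<nu>_scale far_sets) (auto simp: divide_right_mono field_simps simp del: of_nat_Suc)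
    then show ?thesis using 0 by simp
  qed
  then have "emeasure lborel {z \<in> E - {0}. r / Suc n \<le> norm z} = 0" for n
    using emeasure_\<nu>_eq_0_iff[OF far_sets(2)] by blast
  then have "emeasure lborel (\<Union>n. {z \<in> E - {0}. r / Suc n \<le> norm z}) = 0"
    by (intro emeasure_UN_eq_0) (use far_sets(2) sets_punctured in auto)
  moreover have "(\<Union>n. {z \<in> E - {0}. r / Suc n \<le> norm z}) = E - {0}"
  proof -
    have "\<exists>n. r / Suc n \<le> norm z" if "z \<noteq> 0" for z :: 'a
    proof -
      have "0 < norm z / r" using that r by simp
      from reals_Archimedean[OF this] obtain n where "inverse (real (Suc n)) < norm z / r" by blast
      then have "r / Suc n \<le> norm z" using r by (simp add: field_simps less_imp_le)
      then show ?thesis ..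
    qed
    then show ?thesis by auto
  qed
  ultimately show False using E by simp
qed

text \<open>For an exactly homogeneous loss no approximation is involved: at every u > 0, X/u lies
  in the level set precisely when X lies in the exceedance set at level u.\<close>

lemma measure_scaled_law_level_set:
  assumes X: "X u \<in> borel_measurable (N u)" and N: "prob_space (N u)"
    and g: "cone_functional UNIV g" and u: "0 < u"
  shows "measure (scaled_law E s N X u) (level_set E g)
    = u powr s * \<P>(\<omega> in N u. X u \<omega> \<in> joint_exceedance E (\<lambda>_. g) u {1::nat})"
proof -
  interpret prob_space "N u" by fact
  have "level_set E g \<in> sets punctured"
    using level_set_borel[OF closed_E g] cone_functional_0[OF g]
    unfolding sets_punctured by (auto simp: level_set_def)
  moreover have "X u \<omega> /\<^sub>R u \<in> level_set E g \<longleftrightarrow> X u \<omega> \<in> joint_exceedance E (\<lambda>_. g) u {1::nat}" for \<omega>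
  proof -
    have "g (X u \<omega> /\<^sub>R u) = g (X u \<omega>) / u"
      using cone_functional_scaleR[OF g, of "X u \<omega>" "inverse u"] u by (simp add: divide_inverse mult.commute)
    moreover have "X u \<omega> /\<^sub>R u \<in> E \<longleftrightarrow> X u \<omega> \<in> E"
      using u by (intro cone_scaleR_iff[OF cone_E]) simp
    ultimately show ?thesis using u by (simp add: level_set_def joint_exceedance_def le_divide_eq)
  qed
  ultimately have "emeasure (scaled_law E s N X u) (level_set E g)
      = ennreal (u powr s * \<P>(\<omega> in N u. X u \<omega> \<in> joint_exceedance E (\<lambda>_. g) u {1::nat}))"
    using emeasure_scaled_law[of X u N, OF X, of "level_set E g"]
    by (simp add: emeasure_eq_measure ennreal_mult)
  then show ?thesis by (rule measure_eq_emeasure_eq_ennreal[rotated]) simp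
qed

lemma tail_preservingI:
  assumes E: "emeasure lborel (E - {0}) \<noteq> 0"
    and X: "\<And>u. 0 < u \<Longrightarrow> X u \<in> borel_measurable (N u)"
    and N: "\<And>u. 0 < u \<Longrightarrow> prob_space (N u)"
    and conv: "\<And>g. cone_functional UNIV g \<Longrightarrow> emeasure lborel (level_set E g) \<noteq> 0 \<Longrightarrow>
      ((\<lambda>u. u powr s * \<P>(\<omega> in N u. X u \<omega> \<in> joint_exceedance E (\<lambda>_. g) u {1::nat}))
        \<longlongrightarrow> measure \<nu> (level_set E g)) at_top"
  shows "tail_preserving E s \<phi> N X"
  unfolding tail_preserving_def
proof (rule M0_tendstoI_level_sets[OF closed_E])
  let ?\<mu> = "scaled_law E s N X"
  show M0: "\<forall>\<^sub>F u in at_top. ?\<mu> u \<in> M0 E"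
    using eventually_gt_at_top[of 0] by eventually_elim (intro scaled_law_in_M0 X N)
  show "\<nu> \<in> M0 E" by (rule \<nu>_in_M0)
  have conv': "((\<lambda>u. measure (?\<mu> u) (level_set E g)) \<longlongrightarrow> measure \<nu> (level_set E g)) at_top"
    if g: "cone_functional UNIV g" and "emeasure lborel (level_set E g) \<noteq> 0" for g
    using conv[OF that]
  proof (rule Lim_transform_eventually)
    show "\<forall>\<^sub>F u in at_top. u powr s * \<P>(\<omega> in N u. X u \<omega> \<in> joint_exceedance E (\<lambda>_. g) u {1::nat})
      = measure (?\<mu> u) (level_set E g)"
      using eventually_gt_at_top[of 0]
      by eventually_elim (simp add: measure_scaled_law_level_set[of X _ N, OF X N g])
  qed
  fix g :: "'a \<Rightarrow> real" assume g: "cone_functional UNIV g"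
  have sets: "level_set E h \<in> sets punctured" if "cone_functional UNIV h" for h
    using level_set_borel[OF closed_E that] cone_functional_0[OF that]
    unfolding sets_punctured by (auto simp: level_set_def)
  show "((\<lambda>u. measure (?\<mu> u) (level_set E g)) \<longlongrightarrow> measure \<nu> (level_set E g)) at_top"
  proof (cases "emeasure lborel (level_set E g) = 0")
    case False
    then show ?thesis using conv'[OF g] by simp
  next
    case True
    then have g0: "emeasure \<nu> (level_set E g) = 0" using emeasure_\<nu>_eq_0_iff[OF sets[OF g]] by simp
    have "((\<lambda>u. measure (?\<mu> u) (level_set E g)) \<longlongrightarrow> 0) at_top"
    proof (rule order_tendstoI)
      fix l :: real assume "l < 0"
      then show "\<forall>\<^sub>F u in at_top. l < measure (?\<mu> u) (level_set E g)"
        by (intro always_eventually allI less_le_trans[OF _ measure_nonneg])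
    next
      fix e :: real assume e: "0 < e"
      \<comment> \<open>The level set of \<open>b n\<close> is the part of the cone with norm at
        least n+1; its \<nu>-mass is a constant times (n+1)^-s and tends to 0.\<close>
      define b where "b n z = (1 / Suc n) * norm z" for n and z :: 'a
      have b: "cone_functional UNIV (b n)" for n unfolding b_def by (rule cone_functional_norm)
      have b_set: "level_set E (b n) = joint_exceedance E (\<lambda>_. norm) (Suc n) {1}" for n
        by (auto simp: level_set_def joint_exceedance_def b_def field_simps)
      have nrm: "cone_functional E norm" using cone_functional_norm[of E 1] by simp
      have "measure \<nu> (level_set E (b n)) = Suc n powr - s * measure \<nu> (joint_exceedance E (\<lambda>_. norm) 1 {1})" for n
        unfolding b_set measure_def
        by (subst emeasure_joint_exceedance_scale) (auto simp: nrm enn2real_mult)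
      moreover have "(\<lambda>n. Suc n powr - s * measure \<nu> (joint_exceedance E (\<lambda>_. norm) 1 {1})) \<longlonglongrightarrow> 0"
        using s_pos
        by (intro tendsto_mult_left_zero tendsto_neg_powr filterlim_compose[OF filterlim_real_sequentially filterlim_Suc]) auto
      ultimately have "(\<lambda>n. measure \<nu> (level_set E (b n))) \<longlonglongrightarrow> 0" by simp
      then have "\<forall>\<^sub>F n in sequentially. measure \<nu> (level_set E (b n)) < e"
        using e by (rule order_tendstoD(2))
      then obtain n where n: "measure \<nu> (level_set E (b n)) < e" unfolding eventually_sequentially by blast
      define h where "h z = max (g z) (b n z)" for z
      have h: "cone_functional UNIV h" unfolding h_def by (intro cone_functional_max g b)
      have hU: "level_set E h = level_set E g \<union> level_set E (b n)"
        by (auto simp: level_set_def h_def le_max_iff_disj)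
      have "level_set E (b n) = {z \<in> E - {0}. real (Suc n) \<le> norm z}"
        by (auto simp: level_set_def b_def field_simps)
      then have "emeasure \<nu> (level_set E (b n)) \<noteq> 0" using emeasure_\<nu>_far_pos[OF E, of "real (Suc n)"] by simp
      moreover have "emeasure \<nu> (level_set E (b n)) \<le> emeasure \<nu> (level_set E h)"
        using sets[OF h] by (intro emeasure_mono) (auto simp: hU sets_\<nu>)
      ultimately have "emeasure \<nu> (level_set E h) \<noteq> 0" by auto
      then have "emeasure lborel (level_set E h) \<noteq> 0" using emeasure_\<nu>_eq_0_iff[OF sets[OF h]] by simp
      \<comment> \<open>The far part has positive mass, which makes \<open>h\<close> admissible
        although \<open>g\<close> is not; as the level set of \<open>g\<close> is \<nu>-null, adding
        it does not raise the limit mass above e.\<close>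
      then have lim: "((\<lambda>u. measure (?\<mu> u) (level_set E h)) \<longlongrightarrow> measure \<nu> (level_set E h)) at_top"
        by (rule conv'[OF h])
      have "emeasure \<nu> (level_set E h) \<le> emeasure \<nu> (level_set E (b n))"
        unfolding hU using emeasure_subadditive[of "level_set E g" \<nu> "level_set E (b n)"] sets[OF g] sets[OF b] g0
        by (simp add: sets_\<nu>)
      then have "emeasure \<nu> (level_set E h) = emeasure \<nu> (level_set E (b n))"
        using \<open>emeasure \<nu> (level_set E (b n)) \<le> emeasure \<nu> (level_set E h)\<close> by simp
      then have "measure \<nu> (level_set E h) < e" using n by (simp add: measure_def)
      from order_tendstoD(2)[OF lim this] M0
      show "\<forall>\<^sub>F u in at_top. measure (?\<mu> u) (level_set E g) < e"
      proof eventually_elim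
        case (elim u)
        have "measure (?\<mu> u) (level_set E g) \<le> measure (?\<mu> u) (level_set E h)"
          by (intro measure_M0_mono[OF closed_E elim(2) h] level_set_borel closed_E g h) (auto simp: hU)
        with elim show ?case by simp
      qed
    qed
    then show ?thesis using g0 by (simp add: measure_def)
  qed
qed

end

theorem proposition1:
  fixes E :: "'a::euclidean_space set"
    and M :: "'b measure" and \<xi> :: "'b \<Rightarrow> 'a"
    and f \<phi> :: "'a \<Rightarrow> real" and s :: real
    and N :: "real \<Rightarrow> 'c measure" and X :: "real \<Rightarrow> 'c \<Rightarrow> 'a"
  assumes "closed E" and "cone E"
    and "prob_space M"
    and "distributed M lborel \<xi> (\<lambda>z. ennreal (f z))"
    and "\<And>z. 0 \<le> f z" and "\<And>z. z \<notin> E \<Longrightarrow> f z = 0"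
    and "density_regularly_varying E f s \<phi>"
    and "\<And>u. 0 < u \<Longrightarrow> prob_space (N u)"
    and "\<And>u. 0 < u \<Longrightarrow> X u \<in> borel_measurable (N u)"
    and "\<And>u \<omega>. 0 < u \<Longrightarrow> \<omega> \<in> space (N u) \<Longrightarrow> X u \<omega> \<in> E"
  shows "(tail_preserving E s \<phi> N X \<longrightarrow>
           (\<forall>K L Lstar \<JJ> J.
              \<JJ> \<subseteq> Pow {1..K} - {{}} \<and>
              asymp_homogeneous_system E K L Lstar \<and>
              regular_system E Lstar \<JJ> \<and> J \<in> \<JJ> \<longrightarrow>
              (\<lambda>u. \<P>(\<omega> in N u. X u \<omega> \<in> joint_exceedance E L u J))
                \<sim>[at_top] (\<lambda>u. \<P>(\<omega> in M. \<xi> \<omega> \<in> joint_exceedance E L u J))))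
       \<and> (\<not> tail_preserving E s \<phi> N X \<longrightarrow>
           (\<exists>K L Lstar \<JJ> J.
              1 \<le> K \<and>
              \<JJ> \<subseteq> Pow {1..K} - {{}} \<and>
              asymp_homogeneous_system E K L Lstar \<and>
              regular_system E Lstar \<JJ> \<and> J \<in> \<JJ> \<and>
              \<not> (\<lambda>u. \<P>(\<omega> in N u. X u \<omega> \<in> joint_exceedance E L u J))
                \<sim>[at_top] (\<lambda>u. \<P>(\<omega> in M. \<xi> \<omega> \<in> joint_exceedance E L u J))))"
proof -
  interpret M: prob_space M by fact
  have \<xi>m: "\<xi> \<in> borel_measurable M" using distributed_measurable[OF assms(4)] by simp
  have fm: "(\<lambda>z. ennreal (f z)) \<in> borel_measurable borel"
    using distributed_borel_measurable[OF assms(4)] by simp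
  \<comment> \<open>A probability density vanishing off \<open>E\<close> cannot live on a Lebesgue
    null set. This yields nonemptiness of the cone and later the admissibility of the perturbed
    functionals.\<close>
  have E0: "emeasure lborel (E - {0}) \<noteq> 0"
  proof
    assume 0: "emeasure lborel (E - {0}) = 0"
    have "E - {0} \<in> sets borel" using assms(1) by auto
    then have "AE z in lborel. z \<notin> E - {0}"
      using 0 by (intro AE_not_in) (auto simp: null_sets_def)
    then have "AE z in lborel. ennreal (f z) = 0"
      using AE_lborel_singleton[of "0::'a"] by eventually_elim (use assms(6) in auto)
    then have "(\<integral>\<^sup>+z. ennreal (f z) * indicator UNIV z \<partial>lborel) = 0"
      using fm by (subst nn_integral_0_iff_AE) auto
    then have "emeasure M (\<xi> -` UNIV \<inter> space M) = 0"
      using distributed_emeasure[OF assms(4), of UNIV] by simp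
    then show False using M.emeasure_space_1 by simp
  qed
  then have "E \<noteq> {}" by auto
  then interpret homogeneous_tail E s \<phi>
    by (rule homogeneous_tail_of_density[OF assms(1,2) _ assms(7)])
  have self: "tail_preserving E s \<phi> (\<lambda>_. M) (\<lambda>_. \<xi>)"
    by (rule tail_preserving_self) fact+
  have lim_\<xi>: "((\<lambda>u. u powr s * \<P>(\<omega> in M. \<xi> \<omega> \<in> joint_exceedance E L u J))
      \<longlongrightarrow> measure \<nu> (joint_exceedance E Lstar 1 J)) at_top"
    if sys: "asymp_homogeneous_system E K L Lstar" and J: "J \<subseteq> {1..K}" "J \<noteq> {}" for K L Lstar J
    using J asymp_homogeneous_of_system[OF sys] finite_subset[OF J(1)]
    by (intro joint_exceedance_tail_limit[OF self \<xi>m assms(3)]) auto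
  show ?thesis
  proof (intro conjI impI allI)
    fix K L Lstar and \<JJ> :: "nat set set" and J
    assume tp: "tail_preserving E s \<phi> N X"
    assume "\<JJ> \<subseteq> Pow {1..K} - {{}} \<and> asymp_homogeneous_system E K L Lstar \<and>
      regular_system E Lstar \<JJ> \<and> J \<in> \<JJ>"
    then have J: "J \<subseteq> {1..K}" "J \<noteq> {}" and sys: "asymp_homogeneous_system E K L Lstar"
      and reg: "emeasure lborel (joint_exceedance E Lstar 1 J) \<noteq> 0"
      by (auto simp: regular_system_def)
    have fin: "finite J" using finite_subset[OF J(1)] by simp
    have Lst: "cone_functional E (Lstar j)" if "j \<in> J" for j
      using asymp_homogeneous_limit_cone_functional[OF cone_E asymp_homogeneous_of_system(1)[OF sys]] that J by blast
    have "emeasure \<nu> (joint_exceedance E Lstar 1 J) \<noteq> 0"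
      using reg emeasure_\<nu>_eq_0_iff joint_exceedance_sets[OF Lst fin J(2)] by simp
    \<comment> \<open>Finiteness is needed to pass to the real-valued \<open>measure\<close>, which
      would return 0 on a set of infinite mass.\<close>
    moreover have "emeasure \<nu> (joint_exceedance E Lstar 1 J) < \<infinity>"
      by (rule emeasure_joint_exceedance_finite[OF Lst fin J(2)]) auto
    ultimately have "measure \<nu> (joint_exceedance E Lstar 1 J) \<noteq> 0"
      by (auto simp: measure_def enn2real_eq_0_iff)
    moreover have "((\<lambda>u. u powr s * \<P>(\<omega> in N u. X u \<omega> \<in> joint_exceedance E L u J))
      \<longlongrightarrow> measure \<nu> (joint_exceedance E Lstar 1 J)) at_top"
      using J asymp_homogeneous_of_system[OF sys] fin
      by (intro joint_exceedance_tail_limit[OF tp assms(9,8)]) auto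
    ultimately show "(\<lambda>u. \<P>(\<omega> in N u. X u \<omega> \<in> joint_exceedance E L u J))
        \<sim>[at_top] (\<lambda>u. \<P>(\<omega> in M. \<xi> \<omega> \<in> joint_exceedance E L u J))"
      using lim_\<xi>[OF sys J] by (intro asymp_equiv_of_scaled_limits[of s])
  next
    assume ntp: "\<not> tail_preserving E s \<phi> N X"
    show "\<exists>K L Lstar \<JJ> J. 1 \<le> K \<and> \<JJ> \<subseteq> Pow {1..K} - {{}} \<and>
        asymp_homogeneous_system E K L Lstar \<and> regular_system E Lstar \<JJ> \<and> J \<in> \<JJ> \<and>
        \<not> (\<lambda>u. \<P>(\<omega> in N u. X u \<omega> \<in> joint_exceedance E L u J))
          \<sim>[at_top] (\<lambda>u. \<P>(\<omega> in M. \<xi> \<omega> \<in> joint_exceedance E L u J))" (is ?counterexample)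
    proof (rule ccontr)
      assume no: "\<not> ?counterexample"
      have "tail_preserving E s \<phi> N X"
      proof (rule tail_preservingI[OF E0 assms(9,8)])
        fix g :: "'a \<Rightarrow> real"
        assume g: "cone_functional UNIV g" and pos: "emeasure lborel (level_set E g) \<noteq> 0"
        then have "level_set E g \<noteq> {}" by auto
        then obtain z where "z \<in> E" "1 \<le> g z" unfolding level_set_def by blast
        then have "z \<in> E" "0 < g z" by simp_all
        then have sys: "asymp_homogeneous_system E 1 (\<lambda>_. g) (\<lambda>_. g)"
          by (rule cone_functional_system[OF g])
        have reg: "regular_system E (\<lambda>_. g) {{1}}"
          using pos by (simp add: regular_system_def level_set_eq_joint_exceedance)
        have "(\<lambda>u. \<P>(\<omega> in N u. X u \<omega> \<in> joint_exceedance E (\<lambda>_. g) u {1::nat}))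
          \<sim>[at_top] (\<lambda>u. \<P>(\<omega> in M. \<xi> \<omega> \<in> joint_exceedance E (\<lambda>_. g) u {1}))"
        proof (rule ccontr)
          assume neq: "\<not> ?thesis"
          have ?counterexample
            by (rule exI[of _ 1], rule exI[of _ "\<lambda>_. g"], rule exI[of _ "\<lambda>_. g"],
                rule exI[of _ "{{1}}"], rule exI[of _ "{1}"], intro conjI sys reg neq) auto
          with no show False by contradiction
        qed
        then show "((\<lambda>u. u powr s * \<P>(\<omega> in N u. X u \<omega> \<in> joint_exceedance E (\<lambda>_. g) u {1::nat}))
          \<longlongrightarrow> measure \<nu> (level_set E g)) at_top"
          unfolding level_set_eq_joint_exceedance
          by (rule scaled_limit_of_asymp_equiv[OF _ lim_\<xi>[OF sys]]) auto
      qed auto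
      with ntp show False by blast
    qed
  qed
qed

end
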